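(* Let $\mathcal{C}_1\subseteq\mathbb{F}_{q^m}^n$ be a linear code, $\mathcal{C}_2\subsetneqq\mathcal{C}_1$ a subcode with $\dim\mathcal{C}_2=\dim\mathcal{C}_1-l$, $l\ge 1$, and $\psi:\mathbb{F}_{q^m}^l\to\mathcal{C}_1/\mathcal{C}_2$ a linear bijection. Let $(S,X)$ be random variables with an arbitrary joint distribution such that $S\in\mathbb{F}_{q^m}^l$ and $X\in\psi(S)$. Let $0\le\mu\le n$. Then $$K_{R,\mu}(\mathcal{C}_2^\perp,\mathcal{C}_1^\perp)-D(S\|U_{\mathbb{F}_{q^m}^l})\ \le\ \max_{B\in\mathbb{F}_q^{\mu\times n}} I(S;BX^{\rm T})\ \le\ K_{R,\mu}(\mathcal{C}_2^\perp,\mathcal{C}_1^\perp)+D(X\|U_{\psi(S)}|S).$$ If $S$ and $X$ are uniformly distributed over $\mathbb{F}_{q^m}^l$ and $\mathcal{C}_1$ respectively, then $\max_{B\in\mathbb{F}_q^{\mu\times n}} I(S;BX^{\rm T})=K_{R,\mu}(\mathcal{C}_2^\perp,\mathcal{C}_1^\perp)$. If $\max_{B\in\mathbb{F}_q^{\mu\times n}} I(S;BX^{\rm T})=0$ and the distribution of $S$ assigns a positive probability to every element of $\mathbb{F}_{q^m}^l$, then $K_{R,\mu}(\mathcal{C}_2^\perp,\mathcal{C}_1^\perp)=0$.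
   Context: $\mathbb{F}_{q^m}$ is the degree-$m$ extension ($m\ge1$) of the finite field $\mathbb{F}_q$. Linear codes are $\mathbb{F}_{q^m}$-subspaces of the row space $\mathbb{F}_{q^m}^n$; dimensions are over $\mathbb{F}_{q^m}$; $\mathcal{C}^\perp$ is the dual code for the standard bilinear form. For a subspace $V\subseteq\mathbb{F}_{q^m}^n$ put $V^q=\{[v_1^q,\dots,v_n^q]: v\in V\}$. Let $\Gamma(\mathbb{F}_{q^m}^n)$ be the set of $\mathbb{F}_{q^m}$-subspaces $V\subseteq\mathbb{F}_{q^m}^n$ with $V=V^q$, and $\Gamma_i(\mathbb{F}_{q^m}^n)$ those of dimension $i$. For codes $\mathcal{D}_2\subsetneqq\mathcal{D}_1\subseteq\mathbb{F}_{q^m}^n$ and $0\le i\le n$, the $i$-th relative dimension/intersection profile (RDIP) is $K_{R,i}(\mathcal{D}_1,\mathcal{D}_2)=\max_{V\in\Gamma_i(\mathbb{F}_{q^m}^n)}\{\dim(\mathcal{D}_1\cap V)-\dim(\mathcal{D}_2\cap V)\}$. All entropies, mutual informations $I$ and relative entropies $D$ use logarithms to base $q^m$. $U_{\mathcal{A}}$ is a uniform random variable on the finite set $\mathcal{A}$; $D(S\|U_{\mathbb{F}_{q^m}^l})$ is the relative entropy between the distribution of $S$ and the uniform distribution; $D(X\|U_{\psi(S)}|S)=\sum_s P_S(s)\,D(P_{X|S=s}\,\|\,\text{uniform distribution on the coset }\psi(s))$. *)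

theory Defs
  imports "HOL-Analysis.Analysis" "HOL-Probability.Information"
    "HOL-Probability.Probability_Mass_Function"
begin

text \<open>
  The field \<open>\<F>\<^bsub>q^m\<^esub>\<close> is a finite field type \<open>'a\<close> and \<open>\<F>\<^bsub>q\<^esub>\<close> a subfield
  with \<open>q\<close> elements, given as a subset of \<open>'a\<close>. Row vectors of length \<open>n\<close> are elements of
  \<open>'a ^ 'n\<close> with \<open>CARD('n) = n\<close>; subspaces and dimensions over \<open>'a\<close> are \<open>vec.subspace\<close>
  and \<open>vec.dim\<close>.
\<close>

definition is_subfield :: "'a::field set \<Rightarrow> bool" where
  "is_subfield F \<longleftrightarrow> 0 \<in> F \<and> 1 \<in> F \<and>
    (\<forall>x\<in>F. \<forall>y\<in>F. x + y \<in> F \<and> x * y \<in> F) \<and>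
    (\<forall>x\<in>F. - x \<in> F \<and> inverse x \<in> F)"

definition std_bilinear :: "'a::comm_ring_1 ^ 'n \<Rightarrow> 'a ^ 'n \<Rightarrow> 'a" where
  "std_bilinear v w = (\<Sum>j\<in>UNIV. v $ j * w $ j)"

definition dual_code :: "('a::comm_ring_1 ^ 'n) set \<Rightarrow> ('a ^ 'n) set" where
  "dual_code C = {w. \<forall>v\<in>C. std_bilinear v w = 0}"

definition frob_image :: "nat \<Rightarrow> ('a::field ^ 'n) set \<Rightarrow> ('a ^ 'n) set" where
  "frob_image q V = (\<lambda>v. \<chi> j. (v $ j) ^ q) ` V"

definition Gamma_spaces :: "nat \<Rightarrow> ('a::field ^ 'n) set set" where
  "Gamma_spaces q = {V. vec.subspace V \<and> frob_image q V = V}"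

definition Gamma_spaces_dim :: "nat \<Rightarrow> nat \<Rightarrow> ('a::field ^ 'n) set set" where
  "Gamma_spaces_dim q i = {V \<in> Gamma_spaces q. vec.dim V = i}"

text \<open>The set over which the maximum is taken is nonempty for \<open>i \<le> n\<close>.\<close>

definition RDIP ::
  "nat \<Rightarrow> nat \<Rightarrow> ('a::{field,finite} ^ 'n) set \<Rightarrow> ('a ^ 'n) set \<Rightarrow> int" where
  "RDIP q i D1 D2 =
    Max ((\<lambda>V. int (vec.dim (D1 \<inter> V)) - int (vec.dim (D2 \<inter> V))) ` Gamma_spaces_dim q i)"

text \<open>
  Elements of \<open>C1 / C2\<close> are cosets, i.e. sets of vectors. In the scalar multiple of a coset, the
  summand \<open>C2\<close> is needed for the scalar \<open>0\<close>.
\<close>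

definition quotient_code :: "('a::field ^ 'n) set \<Rightarrow> ('a ^ 'n) set \<Rightarrow> ('a ^ 'n) set set" where
  "quotient_code C1 C2 = (\<lambda>x. x +o C2) ` C1"

definition quotient_scale :: "('a::field ^ 'n) set \<Rightarrow> 'a \<Rightarrow> ('a ^ 'n) set \<Rightarrow> ('a ^ 'n) set" where
  "quotient_scale C2 c A = ((*s) c ` A) + C2"

definition linear_to_quotient ::
  "('a::field ^ 'n) set \<Rightarrow> ('a ^ 'l \<Rightarrow> ('a ^ 'n) set) \<Rightarrow> bool" where
  "linear_to_quotient C2 \<psi> \<longleftrightarrow>
    (\<forall>s t. \<psi> (s + t) = \<psi> s + \<psi> t) \<and> (\<forall>c s. \<psi> (c *s s) = quotient_scale C2 c (\<psi> s))"

text \<open>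
  A \<open>\<mu> \<times> n\<close> matrix over \<open>F\<close> is the list of its \<open>\<mu>\<close> rows, because \<open>\<mu> = 0\<close> has to be
  admitted (index types are never empty). Accordingly, \<open>B x\<^sup>T\<close> is a list of length \<open>\<mu>\<close>.
\<close>

definition matrices_over :: "'a set \<Rightarrow> nat \<Rightarrow> ('a::comm_ring_1 ^ 'n) list set" where
  "matrices_over F \<mu> = {B. length B = \<mu> \<and> (\<forall>b\<in>set B. \<forall>j. b $ j \<in> F)}"

definition mat_apply :: "('a::comm_ring_1 ^ 'n) list \<Rightarrow> 'a ^ 'n \<Rightarrow> 'a list" where
  "mat_apply B x = map (\<lambda>b. std_bilinear b x) B"

text \<open>
  \<open>rel_entropy b P Q\<close> is \<open>D(P \<parallel> Q)\<close>; \<open>KL_divergence\<close> takes the reference measure \<open>Q\<close> first.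
\<close>

definition rel_entropy :: "real \<Rightarrow> 'b measure \<Rightarrow> 'b measure \<Rightarrow> real" where
  "rel_entropy b P Q = KL_divergence b Q P"

definition uniform_on :: "'b set \<Rightarrow> 'b measure" where
  "uniform_on A = measure_pmf (pmf_of_set A)"

definition law :: "'w measure \<Rightarrow> ('w \<Rightarrow> 'b) \<Rightarrow> 'b measure" where
  "law M X = distr M (count_space UNIV) X"

definition event_eq :: "'w measure \<Rightarrow> ('w \<Rightarrow> 's) \<Rightarrow> 's \<Rightarrow> 'w set" where
  "event_eq M S s = {w \<in> space M. S w = s}"

text \<open>
  The conditional law of \<open>X\<close> given \<open>S = s\<close> is the law of \<open>X\<close> under
  \<open>uniform_measure M (event_eq M S s)\<close>, which is \<open>M\<close> conditioned on that event. Its value for null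
  events is irrelevant since the summand is then multiplied by \<open>0\<close>.
\<close>

definition cond_rel_entropy_uniform ::
  "real \<Rightarrow> 'w measure \<Rightarrow> ('w \<Rightarrow> 's::finite) \<Rightarrow> ('w \<Rightarrow> 'b) \<Rightarrow> ('s \<Rightarrow> 'b set) \<Rightarrow> real" where
  "cond_rel_entropy_uniform b M S X \<psi> =
    (\<Sum>s\<in>UNIV. measure M (event_eq M S s) *
      rel_entropy b (law (uniform_measure M (event_eq M S s)) X) (uniform_on (\<psi> s)))"

definition mutual_info :: "real \<Rightarrow> 'w measure \<Rightarrow> ('w \<Rightarrow> 's) \<Rightarrow> ('w \<Rightarrow> 't) \<Rightarrow> real" where
  "mutual_info b M S Y =
    prob_space.mutual_information M b (count_space (S ` space M)) (count_space (Y ` space M)) S Y"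

definition max_mutual_info ::
  "real \<Rightarrow> 'a::{field,finite} set \<Rightarrow> nat \<Rightarrow> 'w measure \<Rightarrow> ('w \<Rightarrow> 's) \<Rightarrow> ('w \<Rightarrow> 'a ^ 'n) \<Rightarrow> real" where
  "max_mutual_info b F \<mu> M S X =
    Max ((\<lambda>B. mutual_info b M S (\<lambda>w. mat_apply B (X w))) ` matrices_over F \<mu>)"

end

theory Submission
  imports Defs "HOL-Computational_Algebra.Polynomial"
begin

text \<open>
  For a matrix \<open>B\<close> over \<open>F\<close> with row space \<open>V\<close> and kernel \<open>V\<^sup>\<bottom>\<close>, put
  \<open>gain B = dim (B C1) - dim (B C2)\<close>. Symmetry of the rank of the pairing between \<open>Ci\<close> and \<open>V\<close> turns
  this into \<open>dim (C2\<^sup>\<bottom> \<inter> V) - dim (C1\<^sup>\<bottom> \<inter> V)\<close>. This is monotone in \<open>V\<close>, and by Galois descent the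
  Frobenius-stable spaces are exactly the row spaces over \<open>F\<close>; hence \<open>K\<close> is the maximum of the gains.

  For fixed \<open>B\<close> and \<open>Y = B X\<^sup>T\<close>, everything follows from one inequality: if every value of \<open>g U\<close> comes
  from at most \<open>N\<close> values of \<open>U\<close>, then \<open>H(U) \<le> H(g U) + log N\<close>. It bounds \<open>H(Y)\<close>, \<open>H(S, X) - H(S, Y)\<close> and
  \<open>H(S, Y) - H(Y)\<close>, while the two divergences are \<open>l - H(S)\<close> and \<open>dim C2 - H(X | S)\<close>. If \<open>I(S; Y) = 0\<close> and
  all secrets have positive probability, then each of them is compatible with each possible
  observation, which forces the gain to vanish.
\<close>

section \<open>Codes over finite fields and Galois descent\<close>

text \<open>For \<open>a\<close> outside the span of \<open>B\<close>, every element of the larger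
  span is \<open>k *s a + x\<close> for exactly one scalar \<open>k\<close> and one \<open>x\<close>
  in the smaller span, so each new basis vector multiplies the size by
  \<open>CARD('a)\<close>.\<close>

lemma card_span_independent:
  fixes B :: "('a::{field,finite} ^ 'n) set"
  assumes "vec.independent B"
  shows "card (vec.span B) = CARD('a) ^ card B"
proof -
  have "finite B" by simp
  then show ?thesis using assms
  proof (induction B rule: finite_induct)
    case empty
    then show ?case by simp
  next
    case (insert a B)
    have a: "a \<notin> vec.span B" and iB: "vec.independent B"
      using insert.prems insert.hyps vec.independent_insert by metis+
    let ?g = "\<lambda>(k, x). k *s a + x"
    have inj: "inj_on ?g (UNIV \<times> vec.span B)"
    proof (rule inj_onI, clarify)
      fix k x k' x'
      assume x: "x \<in> vec.span B" "x' \<in> vec.span B" and eq: "k *s a + x = k' *s a + x'"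
      have "(k - k') *s a = x' - x"
        using eq by (simp add: vec.scale_left_diff_distrib algebra_simps)
      then have "(k - k') *s a \<in> vec.span B"
        using x vec.span_diff by metis
      then have "inverse (k - k') *s ((k - k') *s a) \<in> vec.span B"
        by (rule vec.span_scale)
      then have "(inverse (k - k') * (k - k')) *s a \<in> vec.span B"
        by (simp only: vec.scale_scale)
      moreover have "inverse (k - k') * (k - k') = 1" if "k \<noteq> k'" using that by simp
      ultimately have "k = k'" using a by (metis vec.scale_one)
      then show "k = k' \<and> x = x'" using eq by simp
    qed
    have img: "?g ` (UNIV \<times> vec.span B) = vec.span (insert a B)"
    proof (intro equalityI subsetI)
      fix y assume "y \<in> ?g ` (UNIV \<times> vec.span B)"
      then obtain k x where "x \<in> vec.span B" "y = k *s a + x" by auto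
      then have "y - k *s a \<in> vec.span B" by simp
      then show "y \<in> vec.span (insert a B)" by (auto simp: vec.span_insert)
    next
      fix y assume "y \<in> vec.span (insert a B)"
      then obtain k where "y - k *s a \<in> vec.span B" by (auto simp: vec.span_insert)
      then have "(k, y - k *s a) \<in> UNIV \<times> vec.span B" by simp
      moreover have "?g (k, y - k *s a) = y" by simp
      ultimately show "y \<in> ?g ` (UNIV \<times> vec.span B)" by (metis image_eqI)
    qed
    have "card (vec.span (insert a B)) = card ((UNIV :: 'a set) \<times> vec.span B)"
      using card_image[OF inj] unfolding img by simp
    also have "\<dots> = CARD('a) * CARD('a) ^ card B"
      by (simp add: card_cartesian_product insert.IH[OF iB])
    finally show ?case using insert.hyps by simp
  qed
qed

text \<open>Turns counting identities into identities between dimensions.\<close>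

lemma card_subspace:
  fixes V :: "('a::{field,finite} ^ 'n) set"
  assumes "vec.subspace V"
  shows "card V = CARD('a) ^ vec.dim V"
proof -
  obtain B where B: "B \<subseteq> V" "vec.independent B" "V \<subseteq> vec.span B" "card B = vec.dim V"
    using vec.basis_exists by metis
  then have "vec.span B = V"
    using assms by (simp add: vec.span_subspace)
  then show ?thesis using card_span_independent[OF B(2)] B(4) by simp
qed

section \<open>The standard bilinear form and the symmetry of its rank\<close>

lemma std_bilinear_commute: "std_bilinear v w = std_bilinear w v"
  by (simp add: std_bilinear_def mult.commute)

lemma std_bilinear_add_right: "std_bilinear v (w + w') = std_bilinear v w + std_bilinear v w'"
  by (simp add: std_bilinear_def algebra_simps sum.distrib)

lemma std_bilinear_diff_right: "std_bilinear v (w - w') = std_bilinear v w - std_bilinear v w'"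
  by (simp add: std_bilinear_def algebra_simps sum_subtractf)

lemma std_bilinear_scale_right: "std_bilinear v (c *s w) = c * std_bilinear v w"
  by (simp add: std_bilinear_def sum_distrib_left algebra_simps)

lemma std_bilinear_zero_right: "std_bilinear v 0 = 0"
  by (simp add: std_bilinear_def)

lemma subspace_dual_code: "vec.subspace (dual_code C)"
  by (rule vec.subspaceI)
    (auto simp: dual_code_def std_bilinear_zero_right std_bilinear_add_right std_bilinear_scale_right)

lemma dual_code_span: "dual_code (vec.span B) = dual_code B"
proof
  show "dual_code (vec.span B) \<subseteq> dual_code B"
    using vec.span_base by (fastforce simp: dual_code_def)
  show "dual_code B \<subseteq> dual_code (vec.span B)"
  proof
    fix w assume "w \<in> dual_code B"
    then have "B \<subseteq> dual_code {w}" by (auto simp: dual_code_def std_bilinear_commute)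
    then have "vec.span B \<subseteq> dual_code {w}"
      by (simp add: vec.span_minimal subspace_dual_code)
    then show "w \<in> dual_code (vec.span B)"
      by (auto simp: dual_code_def std_bilinear_commute)
  qed
qed

text \<open>\<open>v0\<close> spans a complement in \<open>V\<close> of the kernel of
  \<open>c\<close>: subtracting a suitable multiple of \<open>v0\<close> moves any \<open>y\<close>
  into that kernel.\<close>

lemma card_kernel_functional:
  fixes V :: "('a::{field,finite} ^ 'n) set"
  assumes "vec.subspace V" and "v0 \<in> V" and "std_bilinear c v0 \<noteq> 0"
  shows "CARD('a) * card {v \<in> V. std_bilinear c v = 0} = card V"
proof -
  let ?g = "\<lambda>(k, v). k *s v0 + v"
  let ?W = "{v \<in> V. std_bilinear c v = 0}"
  have "bij_betw ?g (UNIV \<times> ?W) V"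
    unfolding bij_betw_def
  proof
    show "inj_on ?g (UNIV \<times> ?W)"
    proof (rule inj_onI, clarify)
      fix k x k' x'
      assume 0: "std_bilinear c x = 0" "std_bilinear c x' = 0" and eq: "k *s v0 + x = k' *s v0 + x'"
      have "std_bilinear c (k *s v0 + x) = std_bilinear c (k' *s v0 + x')" using eq by simp
      then have "k = k'"
        using 0 assms(3) by (simp add: std_bilinear_add_right std_bilinear_scale_right)
      then show "k = k' \<and> x = x'" using eq by simp
    qed
    show "?g ` (UNIV \<times> ?W) = V"
    proof (intro equalityI subsetI)
      fix y assume "y \<in> ?g ` (UNIV \<times> ?W)"
      then show "y \<in> V" using assms by (auto intro!: vec.subspace_add vec.subspace_scale)
    next
      fix y assume y: "y \<in> V"
      let ?k = "std_bilinear c y / std_bilinear c v0"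
      have "(?k, y - ?k *s v0) \<in> UNIV \<times> ?W" using y assms
        by (auto intro!: vec.subspace_diff vec.subspace_scale
            simp: std_bilinear_diff_right std_bilinear_scale_right)
      moreover have "?g (?k, y - ?k *s v0) = y" by simp
      ultimately show "y \<in> ?g ` (UNIV \<times> ?W)" by (metis (no_types, lifting) image_eqI)
    qed
  qed
  then have "card ((UNIV :: 'a set) \<times> ?W) = card V" by (rule bij_betw_same_card)
  then show ?thesis by (simp add: card_cartesian_product)
qed

text \<open>A vector \<open>c\<close> orthogonal to all of \<open>V\<close> contributes
  \<open>card V\<close> pairs, every other one the fraction \<open>1 / CARD('a)\<close> of that; the
  factor \<open>CARD('a)\<close> on the left avoids division.\<close>

lemma card_orthogonal_pairs:
  fixes C V :: "('a::{field,finite} ^ 'n) set"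
  assumes "vec.subspace V"
  shows "CARD('a) * (\<Sum>c\<in>C. card {v \<in> V. std_bilinear c v = 0}) =
    (CARD('a) - 1) * (card (C \<inter> dual_code V) * card V) + card C * card V"
proof -
  let ?p = "CARD('a)"
  have p: "?p \<ge> 1" by (simp add: Suc_leI)
  have fin: "finite C" by simp
  have "?p * (\<Sum>c\<in>C. card {v \<in> V. std_bilinear c v = 0}) =
      (\<Sum>c\<in>C. ?p * card {v \<in> V. std_bilinear c v = 0})"
    by (simp add: sum_distrib_left)
  also have "\<dots> = (\<Sum>c\<in>C. (if c \<in> dual_code V then (?p - 1) * card V else 0) + card V)"
  proof (rule sum.cong[OF refl])
    fix c
    show "?p * card {v \<in> V. std_bilinear c v = 0} =
        (if c \<in> dual_code V then (?p - 1) * card V else 0) + card V"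
    proof (cases "c \<in> dual_code V")
      case True
      then have "{v \<in> V. std_bilinear c v = 0} = V"
        by (auto simp: dual_code_def std_bilinear_commute)
      with True p show ?thesis by (auto simp: algebra_simps)
    next
      case False
      then obtain v0 where "v0 \<in> V" "std_bilinear c v0 \<noteq> 0"
        by (auto simp: dual_code_def std_bilinear_commute)
      from card_kernel_functional[OF assms this] False show ?thesis by simp
    qed
  qed
  also have "\<dots> = (?p - 1) * (card (C \<inter> dual_code V) * card V) + card C * card V"
    by (simp add: sum.distrib sum.If_cases fin Int_def)
  finally show ?thesis .
qed

lemma card_field_gt_1: "CARD('a::{field,finite}) > 1"
proof -
  have "card {(0::'a), 1} \<le> CARD('a)" by (rule card_mono) auto
  then show ?thesis by simp
qed

text \<open>The orthogonal pairs are counted once over \<open>C\<close> and once over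
  \<open>V\<close>; the common term \<open>card C * card V\<close> and the positive factor
  \<open>CARD('a) - 1\<close> cancel.\<close>

lemma card_pairing_symmetric:
  fixes C V :: "('a::{field,finite} ^ 'n) set"
  assumes "vec.subspace C" and "vec.subspace V"
  shows "card (C \<inter> dual_code V) * card V = card (V \<inter> dual_code C) * card C"
proof -
  have p: "CARD('a) - 1 > 0" using card_field_gt_1[where 'a = 'a] by simp
  have "(\<Sum>c\<in>C. card {v \<in> V. std_bilinear c v = 0}) = (\<Sum>v\<in>V. card {c \<in> C. std_bilinear v c = 0})"
    using sum_multicount_gen[of C V "\<lambda>c v. std_bilinear c v = 0" "\<lambda>v. card {c \<in> C. std_bilinear v c = 0}"]
    by (simp add: std_bilinear_commute)
  then have "(CARD('a) - 1) * (card (C \<inter> dual_code V) * card V) + card C * card V =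
      (CARD('a) - 1) * (card (V \<inter> dual_code C) * card C) + card V * card C"
    using card_orthogonal_pairs[OF assms(1), of V] card_orthogonal_pairs[OF assms(2), of C] by (simp only:)
  then have "(CARD('a) - 1) * (card (C \<inter> dual_code V) * card V) =
      (CARD('a) - 1) * (card (V \<inter> dual_code C) * card C)"
    by (simp only: mult.commute[of "card V"] add_right_cancel)
  with p show ?thesis by (simp only: mult_left_cancel[OF less_imp_neq[OF p, symmetric]])
qed

text \<open>Rearranged, this says that the left and right ranks of the pairing between
  \<open>C\<close> and \<open>V\<close> agree.\<close>

lemma dim_pairing_symmetric:
  fixes C V :: "('a::{field,finite} ^ 'n) set"
  assumes "vec.subspace C" and "vec.subspace V"
  shows "vec.dim (C \<inter> dual_code V) + vec.dim V = vec.dim (V \<inter> dual_code C) + vec.dim C"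
proof -
  have p: "CARD('a) > 1" by (rule card_field_gt_1)
  have "CARD('a) ^ (vec.dim (C \<inter> dual_code V) + vec.dim V) =
      CARD('a) ^ (vec.dim (V \<inter> dual_code C) + vec.dim C)"
    using card_pairing_symmetric[OF assms] assms
    by (simp add: power_add card_subspace vec.subspace_inter subspace_dual_code)
  with p show ?thesis by (simp add: power_inject_exp)
qed

section \<open>The subfield as the fixed points of the Frobenius map\<close>

lemma subfield_power_card:
  fixes F :: "'a::{field,finite} set"
  assumes F: "is_subfield F" and a: "a \<in> F"
  shows "a ^ card F = a"
proof (cases "a = 0")
  case True
  have "card F > 0" using a by (auto simp: card_gt_0_iff)
  with True show ?thesis by simp
next
  case False
  let ?G = "F - {0}"
  \<comment> \<open>Multiplication by \<open>a\<close> permutes the nonzero elements of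
    \<open>F\<close>; comparing the products over \<open>?G\<close> then gives
    \<open>a ^ card ?G = 1\<close>.\<close>
  have img: "(*) a ` ?G = ?G"
  proof (intro equalityI subsetI)
    fix x assume "x \<in> (*) a ` ?G"
    then show "x \<in> ?G" using F a False by (auto simp: is_subfield_def)
  next
    fix x assume "x \<in> ?G"
    then have "inverse a * x \<in> ?G" using F a False by (auto simp: is_subfield_def)
    moreover have "x = a * (inverse a * x)" using False by simp
    ultimately show "x \<in> (*) a ` ?G" by blast
  qed
  have "prod (\<lambda>x. x) ?G = prod (\<lambda>x. x) ((*) a ` ?G)" by (simp add: img)
  also have "\<dots> = (\<Prod>x\<in>?G. a * x)"
    using False by (subst prod.reindex) (auto simp: inj_on_def)
  also have "\<dots> = a ^ card ?G * prod (\<lambda>x. x) ?G" by (simp add: prod.distrib)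
  finally have "a ^ card ?G = 1" by simp
  moreover have "card F = Suc (card ?G)"
    using F by (auto simp: is_subfield_def card_Suc_Diff1 simp del: card_Diff_insert)
  ultimately show ?thesis by simp
qed

text \<open>The elements of \<open>F\<close> already are \<open>card F\<close> roots of a polynomial
  of degree at most \<open>card F\<close>; one more fixed point would be one root too many.\<close>

lemma subfield_eq_power_fixed:
  fixes F :: "'a::{field,finite} set"
  assumes F: "is_subfield F" and x: "x ^ card F = x"
  shows "x \<in> F"
proof (rule ccontr)
  assume "x \<notin> F"
  let ?q = "card F"
  have "card {(0::'a), 1} \<le> ?q" using F by (intro card_mono) (auto simp: is_subfield_def)
  then have q: "?q > 1" by simp
  define P :: "'a poly" where "P = monom 1 ?q - monom 1 1"
  have "coeff P ?q = 1" using q by (simp add: P_def)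
  then have P0: "P \<noteq> 0" by auto
  have "degree P \<le> ?q" unfolding P_def
    by (rule degree_diff_le) (use q in \<open>auto simp: degree_monom_eq\<close>)
  moreover have "insert x F \<subseteq> {y. poly P y = 0}"
    using x subfield_power_card[OF F] by (auto simp: P_def poly_monom)
  then have "card (insert x F) \<le> card {y. poly P y = 0}" by (intro card_mono) auto
  ultimately show False using card_poly_roots_bound[OF P0] \<open>x \<notin> F\<close> by simp
qed

text \<open>
  If the additivity of \<open>x \<mapsto> x\<^sup>q\<close> holds at \<open>(x, y)\<close> for all \<open>x \<in> F\<close>, it holds for all \<open>x\<close>: the
  difference is a polynomial in \<open>x\<close> of degree less than \<open>q\<close> with \<open>q\<close> roots. Applying this in each
  argument gives additivity without using that \<open>q\<close> is a power of the characteristic.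
\<close>

lemma frobenius_add_extend:
  fixes F :: "'a::{field,finite} set"
  assumes q: "card F > 0" and y: "\<And>x. x \<in> F \<Longrightarrow> (x + y) ^ card F = x ^ card F + y ^ card F"
  shows "(x + y) ^ card F = x ^ card F + y ^ card F"
proof -
  let ?q = "card F"
  define R :: "'a poly" where "R = [:y, 1:] ^ ?q - monom 1 ?q - [:y ^ ?q:]"
  have ev: "poly R z = (z + y) ^ ?q - z ^ ?q - y ^ ?q" for z
    by (simp add: R_def poly_monom add.commute)
  have deg: "degree ([:y, 1:] ^ ?q) = ?q"
    by (simp add: degree_power_eq)
  have "coeff ([:y, 1:] ^ ?q) ?q = 1"
    using lead_coeff_power[of "[:y, 1:]" ?q] deg by simp
  \<comment> \<open>The leading terms of the two powers cancel, and the constant polynomial does not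
    reach degree \<open>?q\<close> since \<open>?q > 0\<close>.\<close>
  then have "coeff R ?q = 0" using q by (cases ?q) (simp_all add: R_def)
  moreover have "degree R \<le> ?q"
    unfolding R_def using q by (intro degree_diff_le) (auto simp: deg degree_monom_eq)
  ultimately have R: "R = 0 \<or> degree R < ?q"
    by (metis leading_coeff_0_iff le_neq_implies_less)
  have "R = 0"
  proof (rule ccontr)
    assume nz: "R \<noteq> 0"
    have "F \<subseteq> {z. poly R z = 0}" using y by (auto simp: ev)
    then have "?q \<le> card {z. poly R z = 0}" by (intro card_mono) auto
    with card_poly_roots_bound[OF nz] R nz show False by simp
  qed
  then show ?thesis using ev[of x] by (simp add: algebra_simps)
qed

lemma frobenius_add:
  fixes F :: "'a::{field,finite} set" and x y :: 'a
  assumes F: "is_subfield F"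
  shows "(x + y) ^ card F = x ^ card F + y ^ card F"
proof (rule frobenius_add_extend)
  show q: "card F > 0" using F by (auto simp: is_subfield_def card_gt_0_iff)
  fix a assume a: "a \<in> F"
  have "(y + a) ^ card F = y ^ card F + a ^ card F"
  proof (rule frobenius_add_extend[OF q])
    fix b assume "b \<in> F"
    then show "(b + a) ^ card F = b ^ card F + a ^ card F"
      using a F by (simp add: subfield_power_card is_subfield_def)
  qed
  then show "(a + y) ^ card F = a ^ card F + y ^ card F" by (simp add: add.commute)
qed


section \<open>Galois descent: Frobenius-stable subspaces and rational vectors\<close>

lemma vec_subspace_closed:
  assumes "vec.subspace V" and "u \<in> V"
  shows "v \<in> V \<Longrightarrow> u + v \<in> V" "v \<in> V \<Longrightarrow> u - v \<in> V" "c *s u \<in> V"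
  using assms by (auto intro: vec.subspace_add vec.subspace_diff vec.subspace_scale)

definition rational_vectors :: "'a set \<Rightarrow> ('a ^ 'n) set" where
  "rational_vectors F = {v. \<forall>j. v $ j \<in> F}"

definition vsupport :: "'a::zero ^ 'n \<Rightarrow> 'n set" where
  "vsupport v = {j. v $ j \<noteq> 0}"

text \<open>The difference \<open>?u' - u\<close> lies in \<open>V\<close>, is supported inside
  \<open>vsupport u\<close> and vanishes at \<open>i\<close> because \<open>u $ i = 1\<close>. By
  minimality it is zero, so every coordinate of \<open>u\<close> is fixed by the power map and lies
  in \<open>F\<close>.\<close>

lemma Gamma_spaces_minimal_support:
  fixes F :: "'a::{field,finite} set" and V :: "('a ^ 'n) set"
  assumes F: "is_subfield F" and V: "V \<in> Gamma_spaces (card F)"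
    and u: "u \<in> V" "u $ i = 1"
    and min: "\<And>w. w \<in> V \<Longrightarrow> w \<noteq> 0 \<Longrightarrow> vsupport w \<subseteq> vsupport u \<Longrightarrow> vsupport w = vsupport u"
  shows "u \<in> rational_vectors F"
proof -
  have "card F > 0" using F by (auto simp: is_subfield_def card_gt_0_iff)
  let ?u' = "\<chi> j. (u $ j) ^ card F"
  have sub: "vec.subspace V" using V by (simp add: Gamma_spaces_def)
  have "?u' \<in> V" using V u by (auto simp: Gamma_spaces_def frob_image_def)
  then have "?u' - u \<in> V" using u sub by (simp add: vec_subspace_closed)
  moreover have "vsupport (?u' - u) \<subseteq> vsupport u"
    using \<open>card F > 0\<close> by (auto simp: vsupport_def)
  moreover have "i \<notin> vsupport (?u' - u)" "i \<in> vsupport u"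
    using u(2) by (auto simp: vsupport_def)
  ultimately have "?u' - u = 0" using min by blast
  then have "(u $ j) ^ card F = u $ j" for j by (simp add: vec_eq_iff)
  then show ?thesis using F by (simp add: rational_vectors_def subfield_eq_power_fixed)
qed

text \<open>A vector is reduced to \<open>0\<close> by subtracting multiples of rational minimal-support vectors.\<close>

lemma Gamma_spaces_span_rational:
  fixes F :: "'a::{field,finite} set" and V :: "('a ^ 'n) set"
  assumes F: "is_subfield F" and V: "V \<in> Gamma_spaces (card F)"
  shows "vec.span (V \<inter> rational_vectors F) = V"
proof
  have sub: "vec.subspace V" using V by (simp add: Gamma_spaces_def)
  then show "vec.span (V \<inter> rational_vectors F) \<subseteq> V" by (simp add: vec.span_minimal)
  have "v \<in> vec.span (V \<inter> rational_vectors F)" if "v \<in> V" for v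
    using that
  proof (induction "card (vsupport v)" arbitrary: v rule: less_induct)
    case less
    show ?case
    proof (cases "v = 0")
      case True
      then show ?thesis by (simp add: vec.span_zero)
    next
      case False
      \<comment> \<open>The reducing vector has least support among the nonzero vectors of
        \<open>V\<close> supported inside \<open>v\<close>. Hence its support is minimal in
        \<open>V\<close>, and subtracting its multiples does not enlarge
        \<open>vsupport v\<close>.\<close>
      define P where "P = (\<lambda>w. w \<in> V \<and> w \<noteq> 0 \<and> vsupport w \<subseteq> vsupport v)"
      have "P v" using False less.prems by (simp add: P_def)
      then obtain w where w: "P w" and wmin: "\<And>w'. P w' \<Longrightarrow> card (vsupport w) \<le> card (vsupport w')"
        using arg_min_nat_lemma[of P v "\<lambda>w. card (vsupport w)"] by metis
      obtain i where i: "w $ i \<noteq> 0" using w by (auto simp: P_def vec_eq_iff)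
      define u where "u = inverse (w $ i) *s w"
      have suppu: "vsupport u = vsupport w" using i by (auto simp: u_def vsupport_def)
      have uV: "u \<in> V" using w sub by (simp add: u_def P_def vec_subspace_closed)
      have ui: "u $ i = 1" using i by (simp add: u_def)
      have "u \<in> rational_vectors F"
      proof (rule Gamma_spaces_minimal_support[OF F V uV ui])
        fix w' assume w': "w' \<in> V" "w' \<noteq> 0" "vsupport w' \<subseteq> vsupport u"
        then have "P w'" using w suppu by (auto simp: P_def)
        then have "card (vsupport u) \<le> card (vsupport w')" using wmin suppu by simp
        then show "vsupport w' = vsupport u" using w'(3) by (simp add: card_seteq)
      qed
      then have uspan: "u \<in> vec.span (V \<inter> rational_vectors F)" using uV by (simp add: vec.span_base)
      let ?v' = "v - (v $ i) *s u"
      have "i \<in> vsupport v" using i w by (auto simp: P_def vsupport_def)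
      moreover have "i \<notin> vsupport ?v'" using ui by (simp add: vsupport_def)
      moreover have "vsupport ?v' \<subseteq> vsupport v"
        using w suppu by (auto simp: P_def vsupport_def)
      ultimately have "vsupport ?v' \<subset> vsupport v" by blast
      then have "card (vsupport ?v') < card (vsupport v)" by (simp add: psubset_card_mono)
      moreover have "?v' \<in> V" using less.prems uV sub by (simp add: vec_subspace_closed)
      ultimately have "?v' \<in> vec.span (V \<inter> rational_vectors F)" by (rule less.hyps)
      then have "?v' + (v $ i) *s u \<in> vec.span (V \<inter> rational_vectors F)"
        using uspan by (intro vec.span_add vec.span_scale)
      then show ?thesis by simp
    qed
  qed
  then show "V \<subseteq> vec.span (V \<inter> rational_vectors F)" by blast
qed

text \<open>The coordinatewise power map is semilinear and fixes \<open>B\<close>, so it sends the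
  span into itself; being injective on a finite set, it is onto.\<close>

lemma span_rational_in_Gamma_spaces:
  fixes F :: "'a::{field,finite} set" and B :: "('a ^ 'n) set"
  assumes F: "is_subfield F" and B: "B \<subseteq> rational_vectors F"
  shows "vec.span B \<in> Gamma_spaces (card F)"
proof -
  have q: "card F > 0" using F by (auto simp: is_subfield_def card_gt_0_iff)
  let ?f = "\<lambda>v :: 'a ^ 'n. \<chi> j. (v $ j) ^ card F"
  have sub: "?f v \<in> vec.span B" if "v \<in> vec.span B" for v
    using that
  proof (induction v rule: vec.span_induct_alt)
    case base
    have "?f 0 = 0" using q by (simp add: vec_eq_iff)
    then show ?case by (simp add: vec.span_zero)
  next
    case (step c x y)
    have "?f (c *s x + y) = c ^ card F *s x + ?f y"
      using step.hyps B F
      by (auto simp: vec_eq_iff frobenius_add power_mult_distrib subfield_power_card rational_vectors_def subset_iff)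
    with step show ?case by (simp add: vec.span_add vec.span_scale vec.span_base)
  qed
  have inj: "inj ?f"
  proof (rule injI)
    fix x y assume "?f x = ?f y"
    then have "(x $ j) ^ card F = (y $ j) ^ card F" for j by (simp add: vec_eq_iff)
    \<comment> \<open>Writing \<open>x\<close> as \<open>(x - y) + y\<close> derives injectivity
      from additivity: the power of the difference vanishes.\<close>
    moreover have "(x $ j - y $ j + y $ j) ^ card F = (x $ j - y $ j) ^ card F + (y $ j) ^ card F" for j
      by (rule frobenius_add[OF F])
    ultimately have "(x $ j - y $ j) ^ card F = 0" for j by simp
    then show "x = y" using q by (simp add: vec_eq_iff)
  qed
  have "?f ` vec.span B \<subseteq> vec.span B" using sub by blast
  moreover have "card (?f ` vec.span B) = card (vec.span B)"
    by (rule card_image) (use inj in \<open>simp add: inj_on_def\<close>)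
  ultimately have "?f ` vec.span B = vec.span B" by (simp add: card_subset_eq)
  then show ?thesis by (simp add: Gamma_spaces_def frob_image_def)
qed

lemma span_rational_vectors:
  fixes F :: "'a::field set"
  assumes "is_subfield F"
  shows "vec.span (rational_vectors F :: ('a ^ 'n) set) = UNIV"
proof -
  have "v \<in> vec.span (rational_vectors F)" for v :: "'a ^ 'n"
  proof -
    have "axis i 1 \<in> rational_vectors F" for i :: 'n
      using assms by (simp add: rational_vectors_def axis_def is_subfield_def)
    then have "(\<Sum>i\<in>UNIV. v $ i *s axis i 1) \<in> vec.span (rational_vectors F)"
      by (intro vec.span_sum vec.span_scale vec.span_base)
    then show ?thesis by (simp add: basis_expansion)
  qed
  then show ?thesis by blast
qed

text \<open>A basis \<open>B0\<close> chosen inside \<open>B\<close> extends to a basis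
  \<open>B1\<close> of the whole space made of rational vectors; \<open>\<mu>\<close> elements of
  \<open>B1\<close> that include \<open>B0\<close> span the required space.\<close>

lemma Gamma_spaces_dim_extend:
  fixes F :: "'a::{field,finite} set" and B :: "('a ^ 'n) set"
  assumes F: "is_subfield F" and B: "B \<subseteq> rational_vectors F"
    and d: "vec.dim (vec.span B) \<le> \<mu>" "\<mu> \<le> CARD('n)"
  shows "\<exists>V\<in>Gamma_spaces_dim (card F) \<mu>. vec.span B \<subseteq> V"
proof -
  obtain B0 where B0: "B0 \<subseteq> B" "vec.independent B0" "B \<subseteq> vec.span B0" "card B0 = vec.dim B"
    using vec.basis_exists by metis
  have "B0 \<subseteq> rational_vectors F" using B0 B by blast
  from vec.maximal_independent_subset_extend[OF this B0(2)]
  obtain B1 where B1: "B0 \<subseteq> B1" "B1 \<subseteq> rational_vectors F" "vec.independent B1"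
      "rational_vectors F \<subseteq> vec.span B1" by metis
  have "vec.span B1 = UNIV"
    using B1(4) span_rational_vectors[OF F] by (metis top.extremum_uniqueI vec.span_mono vec.span_span)
  then have "card B1 = CARD('n)"
    using B1(3) by (metis vec.dim_span vec.dim_eq_card_independent vec_dim_card)
  with d B0 B1 obtain B2 where B2: "B0 \<subseteq> B2" "B2 \<subseteq> B1" "card B2 = \<mu>"
    using exists_subset_between[of B0 \<mu> B1] by (auto simp: vec.dim_span)
  have "vec.independent B2" using B1 B2 by (metis vec.independent_mono)
  then have "vec.dim (vec.span B2) = \<mu>" using B2 by (simp add: vec.dim_span vec.dim_eq_card_independent)
  moreover have "vec.span B2 \<in> Gamma_spaces (card F)"
    using F B1 B2 by (intro span_rational_in_Gamma_spaces) auto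
  moreover have "vec.span B \<subseteq> vec.span B2"
    using B0 B2 by (metis vec.span_minimal vec.span_mono vec.subspace_span subset_trans)
  ultimately show ?thesis by (auto simp: Gamma_spaces_dim_def)
qed

text \<open>The rational vectors of \<open>V\<close> span it and so contain a basis; this has
  exactly \<open>\<mu>\<close> elements, which serve as the rows in any order.\<close>

lemma Gamma_spaces_dim_rows:
  fixes F :: "'a::{field,finite} set" and V :: "('a ^ 'n) set"
  assumes F: "is_subfield F" and V: "V \<in> Gamma_spaces_dim (card F) \<mu>"
  shows "\<exists>B\<in>matrices_over F \<mu>. vec.span (set B) = V"
proof -
  have V': "V \<in> Gamma_spaces (card F)" "vec.dim V = \<mu>" using V by (auto simp: Gamma_spaces_dim_def)
  obtain B where B: "B \<subseteq> V \<inter> rational_vectors F" "vec.independent B"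
      "V \<inter> rational_vectors F \<subseteq> vec.span B" "card B = vec.dim (V \<inter> rational_vectors F)"
    using vec.basis_exists by metis
  have "vec.span B = V"
    using Gamma_spaces_span_rational[OF F V'(1)] B
    by (metis subset_antisym vec.span_mono vec.span_span)
  moreover have "card B = \<mu>"
    using V'(2) B(2) \<open>vec.span B = V\<close> by (metis vec.dim_span vec.dim_eq_card_independent)
  moreover obtain xs where "set xs = B" "distinct xs"
    using finite_distinct_list[of B] by auto
  ultimately show ?thesis using B(1)
    by (intro bexI[of _ xs]) (auto simp: matrices_over_def rational_vectors_def distinct_card[symmetric])
qed

text \<open>For the row space \<open>V\<close> of \<open>B\<close>, \<open>dual_code V\<close> is the kernel of \<open>B\<close>.\<close>

lemma RDIP_matrix_bound:
  fixes F :: "'a::{field,finite} set" and C1 C2 :: "('a ^ 'n) set"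
  assumes F: "is_subfield F" and "\<mu> \<le> CARD('n)"
    and C: "vec.subspace C1" "vec.subspace C2" "C2 \<subseteq> C1"
  defines "gain \<equiv> \<lambda>B. int (vec.dim C1) - int (vec.dim C2)
      - int (vec.dim (C1 \<inter> dual_code (set B))) + int (vec.dim (C2 \<inter> dual_code (set B)))"
  shows "\<And>B. B \<in> matrices_over F \<mu> \<Longrightarrow> gain B \<le> RDIP (card F) \<mu> (dual_code C2) (dual_code C1)"
    and "\<exists>B\<in>matrices_over F \<mu>. gain B = RDIP (card F) \<mu> (dual_code C2) (dual_code C1)"
proof -
  define h where "h = (\<lambda>V. int (vec.dim (dual_code C2 \<inter> V)) - int (vec.dim (dual_code C1 \<inter> V)))"
  have RDIP: "RDIP (card F) \<mu> (dual_code C2) (dual_code C1) = Max (h ` Gamma_spaces_dim (card F) \<mu>)"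
    by (simp add: RDIP_def h_def)
  \<comment> \<open>Symmetry of the rank, applied to \<open>C1\<close> and to \<open>C2\<close>,
    trades kernels inside the codes for dual codes inside the row space; the dimension of the row
    space cancels in the difference.\<close>
  have gain: "gain B = h (vec.span (set B))" for B
    using dim_pairing_symmetric[OF C(1), of "vec.span (set B)"]
      dim_pairing_symmetric[OF C(2), of "vec.span (set B)"]
    by (simp add: gain_def h_def dual_code_span Int_commute)
  have h_mono: "h V \<le> h V'" if "V \<subseteq> V'" "vec.subspace V" "vec.subspace V'" for V V'
  proof -
    have D: "vec.subspace V'" "vec.subspace (V' \<inter> dual_code C1)" "vec.subspace (V' \<inter> dual_code C2)"
      "vec.subspace (V \<inter> dual_code C2)"
      using that by (auto intro: vec.subspace_inter subspace_dual_code)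
    \<comment> \<open>Both spaces lie in \<open>V' \<inter> dual_code C2\<close> and they meet in
      \<open>V \<inter> dual_code C1\<close>, so the dimension formula for their sum is the wanted
      inequality.\<close>
    let ?A = "V \<inter> dual_code C2" and ?B = "V' \<inter> dual_code C1"
    have AB: "?A \<inter> ?B = V \<inter> dual_code C1" using C(3) that by (auto simp: dual_code_def)
    have "{x + y |x y. x \<in> ?A \<and> y \<in> ?B} \<subseteq> V' \<inter> dual_code C2"
    proof safe
      fix x y assume "x \<in> V" "x \<in> dual_code C2" "y \<in> V'" "y \<in> dual_code C1"
      moreover then have "y \<in> dual_code C2" using C(3) by (auto simp: dual_code_def)
      ultimately show "x + y \<in> V'" "x + y \<in> dual_code C2"
        using that by (auto intro: vec_subspace_closed subspace_dual_code)
    qed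
    then have "vec.dim {x + y |x y. x \<in> ?A \<and> y \<in> ?B} \<le> vec.dim (V' \<inter> dual_code C2)"
      by (rule vec.dim_subset)
    with vec.dim_sums_Int[OF D(4) D(2)] AB show ?thesis
      by (simp add: h_def Int_commute)
  qed
  have fin: "finite (h ` Gamma_spaces_dim (card F) \<mu>)" by simp
  show bound: "gain B \<le> RDIP (card F) \<mu> (dual_code C2) (dual_code C1)" if B: "B \<in> matrices_over F \<mu>" for B
  proof -
    \<comment> \<open>The rows may be dependent, so the row space can have dimension below
      \<open>\<mu>\<close>; it is enlarged to a stable space of dimension \<open>\<mu>\<close>,
      which does not decrease \<open>h\<close>.\<close>
    have "set B \<subseteq> rational_vectors F" using B by (auto simp: matrices_over_def rational_vectors_def)
    moreover have "vec.dim (vec.span (set B)) \<le> \<mu>"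
      using B vec.dim_le_card'[of "set B"] card_length[of B]
      by (simp add: matrices_over_def vec.dim_span)
    ultimately obtain V where V: "V \<in> Gamma_spaces_dim (card F) \<mu>" "vec.span (set B) \<subseteq> V"
      using Gamma_spaces_dim_extend[OF F] assms(2) by metis
    then have "h (vec.span (set B)) \<le> h V"
      by (intro h_mono) (auto simp: Gamma_spaces_dim_def Gamma_spaces_def)
    also have "h V \<le> Max (h ` Gamma_spaces_dim (card F) \<mu>)" using fin V(1) by simp
    finally show ?thesis by (simp add: gain RDIP)
  qed
  \<comment> \<open>Extending the zero space shows that the maximum ranges over a nonempty
    family.\<close>
  have "vec.dim (vec.span {} :: ('a ^ 'n) set) \<le> \<mu>" by simp
  then have "Gamma_spaces_dim (card F) \<mu> \<noteq> ({} :: ('a ^ 'n) set set)"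
    using Gamma_spaces_dim_extend[OF F, of "{}" \<mu>] assms(2) by auto
  then have "Max (h ` Gamma_spaces_dim (card F) \<mu>) \<in> h ` Gamma_spaces_dim (card F) \<mu>"
    using fin by (intro Max_in) auto
  then obtain V where V: "V \<in> Gamma_spaces_dim (card F) \<mu>" "RDIP (card F) \<mu> (dual_code C2) (dual_code C1) = h V"
    by (auto simp: RDIP)
  from Gamma_spaces_dim_rows[OF F V(1)] V(2)
  show "\<exists>B\<in>matrices_over F \<mu>. gain B = RDIP (card F) \<mu> (dual_code C2) (dual_code C1)"
    by (auto simp: gain)
qed

section \<open>Entropy of finitely supported distributions\<close>

text \<open>Summing over the support only keeps \<open>log b 0\<close> out.\<close>

definition pmf_entropy :: "real \<Rightarrow> 'x pmf \<Rightarrow> real" where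
  "pmf_entropy b p = - (\<Sum>x\<in>set_pmf p. pmf p x * log b (pmf p x))"

text \<open>Change of variables: both sides are the same expectation.\<close>

lemma sum_set_pmf_map_pmf:
  fixes h :: "'y \<Rightarrow> real"
  assumes "finite (set_pmf p)"
  shows "(\<Sum>y\<in>set_pmf (map_pmf g p). pmf (map_pmf g p) y * h y) = (\<Sum>x\<in>set_pmf p. pmf p x * h (g x))"
proof -
  have "(\<Sum>y\<in>set_pmf (map_pmf g p). pmf (map_pmf g p) y * h y) = measure_pmf.expectation (map_pmf g p) h"
    using assms by (subst integral_measure_pmf_real[where A = "set_pmf (map_pmf g p)"]) (auto simp: mult.commute)
  also have "\<dots> = measure_pmf.expectation p (\<lambda>x. h (g x))" by simp
  also have "\<dots> = (\<Sum>x\<in>set_pmf p. pmf p x * h (g x))"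
    using assms by (subst integral_measure_pmf_real[where A = "set_pmf p"]) (auto simp: mult.commute)
  finally show ?thesis .
qed

lemma pmf_entropy_map_pmf:
  assumes "finite (set_pmf p)"
  shows "pmf_entropy b (map_pmf g p) = - (\<Sum>x\<in>set_pmf p. pmf p x * log b (pmf (map_pmf g p) (g x)))"
  unfolding pmf_entropy_def by (subst sum_set_pmf_map_pmf[OF assms]) (rule refl)

lemma pmf_le_pmf_map: "pmf p x \<le> pmf (map_pmf g p) (g x)"
proof -
  have "measure p {x} \<le> measure p (g -` {g x})"
    by (intro measure_pmf.finite_measure_mono) auto
  then show ?thesis by (simp add: pmf_map pmf.rep_eq)
qed

lemma pmf_entropy_map_le:
  assumes fin: "finite (set_pmf p)" and b: "b > 1"
  shows "pmf_entropy b (map_pmf g p) \<le> pmf_entropy b p"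
  unfolding pmf_entropy_map_pmf[OF fin] unfolding pmf_entropy_def
  using b by (auto intro!: sum_mono mult_left_mono simp: pmf_le_pmf_map pmf_positive log_le_cancel_iff
      less_le_trans[OF pmf_positive pmf_le_pmf_map])

text \<open>This is \<open>ln x \<le> x - 1\<close> at \<open>u / t\<close>; both Gibbs-type
  arguments below use it term by term.\<close>

lemma mult_log_le:
  assumes "b > 1" and "t > 0" and "u > 0"
  shows "t * (log b u - log b t) \<le> (u - t) / ln b"
proof -
  have "t * (ln u - ln t) \<le> u - t"
    using ln_le_minus_one[of "u / t"] assms by (simp add: ln_div field_simps)
  then have "t * (ln u - ln t) / ln b \<le> (u - t) / ln b"
    using assms by (intro divide_right_mono) auto
  moreover have "t * (log b u - log b t) = t * (ln u - ln t) / ln b"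
    by (simp add: log_def right_diff_distrib diff_divide_distrib)
  ultimately show ?thesis by simp
qed

text \<open>Gibbs' inequality against the weights \<open>pmf (map_pmf g p) (g x) / N\<close>, whose
  total over the support is at most 1 because each value of \<open>g\<close> is counted at most
  \<open>N\<close> times.\<close>

lemma pmf_entropy_le_map_log_fibre:
  fixes p :: "'x pmf" and g :: "'x \<Rightarrow> 'y"
  assumes fin: "finite (set_pmf p)" and b: "b > 1"
    and N: "\<And>y. card {x \<in> set_pmf p. g x = y} \<le> N"
  shows "pmf_entropy b p \<le> pmf_entropy b (map_pmf g p) + log b N"
proof -
  let ?Q = "pmf (map_pmf g p)"
  obtain x0 where x0: "x0 \<in> set_pmf p" using set_pmf_not_empty[of p] by blast
  have "card {x \<in> set_pmf p. g x = g x0} > 0" using fin x0 by (subst card_gt_0_iff) auto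
  then have N0: "N > 0" using N[of "g x0"] by simp
  have one: "(\<Sum>x\<in>set_pmf p. pmf p x) = 1" using fin by (rule sum_pmf_eq_1) simp
  have Q0: "?Q (g x) > 0" if "x \<in> set_pmf p" for x
    using that by (simp add: pmf_positive)
  have "pmf_entropy b p - pmf_entropy b (map_pmf g p) - log b N =
      (\<Sum>x\<in>set_pmf p. pmf p x * (log b (?Q (g x)) - log b (pmf p x))) - log b N * (\<Sum>x\<in>set_pmf p. pmf p x)"
    by (simp add: pmf_entropy_map_pmf[OF fin] pmf_entropy_def[of b p] one right_diff_distrib sum_subtractf)
  also have "\<dots> = (\<Sum>x\<in>set_pmf p. pmf p x * (log b (?Q (g x)) - log b (pmf p x) - log b N))"
    by (simp add: sum_distrib_left sum_subtractf[symmetric] algebra_simps)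
  also have "\<dots> = (\<Sum>x\<in>set_pmf p. pmf p x * (log b (?Q (g x) / N) - log b (pmf p x)))"
  proof (intro sum.cong refl)
    fix x assume "x \<in> set_pmf p"
    from Q0[OF this] have "log b (?Q (g x) / N) = log b (?Q (g x)) - log b N"
      using b N0 by (simp add: log_divide)
    then show "pmf p x * (log b (?Q (g x)) - log b (pmf p x) - log b N) =
        pmf p x * (log b (?Q (g x) / N) - log b (pmf p x))" by simp
  qed
  also have "\<dots> \<le> (\<Sum>x\<in>set_pmf p. (?Q (g x) / N - pmf p x) / ln b)"
    using b N0 Q0 by (intro sum_mono mult_log_le) (auto simp: pmf_positive)
  also have "\<dots> = ((\<Sum>x\<in>set_pmf p. ?Q (g x)) / N - 1) / ln b"
    by (simp add: sum_divide_distrib[symmetric] sum_subtractf one)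
  also have "\<dots> \<le> 0"
  proof -
    have "(\<Sum>x\<in>set_pmf p. ?Q (g x)) = (\<Sum>y\<in>g ` set_pmf p. \<Sum>x\<in>{x \<in> set_pmf p. g x = y}. ?Q (g x))"
      by (rule sum.image_gen[OF fin])
    also have "\<dots> = (\<Sum>y\<in>g ` set_pmf p. card {x \<in> set_pmf p. g x = y} * ?Q y)" by simp
    also have "\<dots> \<le> (\<Sum>y\<in>g ` set_pmf p. N * ?Q y)"
      using N by (intro sum_mono mult_right_mono) auto
    also have "\<dots> = N * (\<Sum>y\<in>set_pmf (map_pmf g p). ?Q y)" by (simp add: sum_distrib_left)
    also have "(\<Sum>y\<in>set_pmf (map_pmf g p). ?Q y) = 1" using fin by (intro sum_pmf_eq_1) auto
    finally show ?thesis using N0 b by (simp add: field_simps)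
  qed
  finally show ?thesis by simp
qed

text \<open>A constant map has the whole support as its only fibre and an image of entropy
  0.\<close>

lemma pmf_entropy_le_log_card:
  assumes fin: "finite (set_pmf p)" and b: "b > 1" and N: "card (set_pmf p) \<le> N"
  shows "pmf_entropy b p \<le> log b N"
proof -
  have "pmf_entropy b p \<le> pmf_entropy b (map_pmf (\<lambda>_. ()) p) + log b N"
    using N by (intro pmf_entropy_le_map_log_fibre[OF fin b]) simp
  then show ?thesis by (simp add: map_pmf_const pmf_entropy_def)
qed

lemma pmf_entropy_pmf_of_set:
  assumes "finite A" and "A \<noteq> {}" and "b > 1"
  shows "pmf_entropy b (pmf_of_set A) = log b (card A)"
proof -
  have c: "card A > 0" using assms by (simp add: card_gt_0_iff)
  have "log b (1 / card A) = - log b (card A)" using c by (simp add: log_divide)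
  with c assms show ?thesis by (simp add: pmf_entropy_def)
qed

definition pmf_mutual_info :: "real \<Rightarrow> ('x \<times> 'y) pmf \<Rightarrow> real" where
  "pmf_mutual_info b p = pmf_entropy b (map_pmf fst p) + pmf_entropy b (map_pmf snd p) - pmf_entropy b p"

text \<open>Gibbs' inequality against the product of the marginals shows that the support of
  \<open>p\<close> has product mass at least 1. A missing pair \<open>(x, y)\<close> would have
  positive product mass and push the total above 1.\<close>

lemma pmf_mutual_info_nonpos_support:
  fixes p :: "('x \<times> 'y) pmf"
  assumes fin: "finite (set_pmf p)" and b: "b > 1" and le: "pmf_mutual_info b p \<le> 0"
    and x: "x \<in> fst ` set_pmf p" and y: "y \<in> snd ` set_pmf p"
  shows "(x, y) \<in> set_pmf p"
proof (rule ccontr)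
  assume nin: "(x, y) \<notin> set_pmf p"
  let ?A = "set_pmf (map_pmf fst p)" and ?B = "set_pmf (map_pmf snd p)"
  let ?P = "pmf (map_pmf fst p)" and ?Q = "pmf (map_pmf snd p)"
  let ?R = "\<lambda>z. ?P (fst z) * ?Q (snd z)"
  have one: "(\<Sum>z\<in>set_pmf p. pmf p z) = 1" using fin by (rule sum_pmf_eq_1) simp
  have pos: "?P (fst z) > 0" "?Q (snd z) > 0" if "z \<in> set_pmf p" for z
    using that by (auto simp: pmf_positive)
  have "0 \<le> - pmf_mutual_info b p" using le by simp
  also have "\<dots> = (\<Sum>z\<in>set_pmf p. pmf p z * (log b (?P (fst z)) + log b (?Q (snd z)) - log b (pmf p z)))"
    by (simp add: pmf_mutual_info_def pmf_entropy_map_pmf[OF fin] pmf_entropy_def[of b p]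
        algebra_simps sum.distrib sum_subtractf)
  also have "\<dots> = (\<Sum>z\<in>set_pmf p. pmf p z * (log b (?R z) - log b (pmf p z)))"
    using b pos by (intro sum.cong refl) (simp add: log_mult less_imp_neq[symmetric])
  also have "\<dots> \<le> (\<Sum>z\<in>set_pmf p. (?R z - pmf p z) / ln b)"
    using b pos by (intro sum_mono mult_log_le) (auto simp: pmf_positive)
  also have "\<dots> = ((\<Sum>z\<in>set_pmf p. ?R z) - 1) / ln b"
    by (simp add: sum_divide_distrib[symmetric] sum_subtractf one)
  finally have "(\<Sum>z\<in>set_pmf p. ?R z) \<ge> 1" using b by (simp add: zero_le_divide_iff)
  moreover have "(\<Sum>z\<in>set_pmf p. ?R z) + ?R (x, y) = (\<Sum>z\<in>insert (x, y) (set_pmf p). ?R z)"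
    using fin nin by simp
  moreover have "\<dots> \<le> (\<Sum>z\<in>?A \<times> ?B. ?R z)"
    using fin x y by (intro sum_mono2) force+
  moreover have "\<dots> = (\<Sum>a\<in>?A. ?P a) * (\<Sum>c\<in>?B. ?Q c)"
    by (simp add: sum_product sum.cartesian_product case_prod_unfold)
  moreover have "(\<Sum>a\<in>?A. ?P a) = 1" "(\<Sum>c\<in>?B. ?Q c) = 1"
    using fin by (auto intro!: sum_pmf_eq_1 simp del: set_map_pmf) (simp_all)
  moreover have "?R (x, y) > 0"
    using x y by (auto simp: pmf_positive)
  ultimately show False by simp
qed

section \<open>Divergences and mutual information expressed by entropies of mass functions\<close>

lemma rel_entropy_uniform_on:
  assumes A: "finite A" "set_pmf p \<subseteq> A" and b: "b > 1"
  shows "rel_entropy b (measure_pmf p) (uniform_on A) = log b (card A) - pmf_entropy b p"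
proof -
  have ne: "A \<noteq> {}" using A(2) set_pmf_not_empty[of p] by blast
  then have c: "card A > 0" using A by (simp add: card_gt_0_iff)
  let ?u = "pmf_of_set A"
  let ?f = "\<lambda>x. real (card A) * pmf p x"
  \<comment> \<open>\<open>?f\<close> is the density of \<open>p\<close> with respect to the uniform
    distribution; outside \<open>A\<close> both vanish because \<open>p\<close> is supported in
    \<open>A\<close>.\<close>
  have "density (measure_pmf ?u) ?f = density (count_space UNIV) (\<lambda>x. ennreal (pmf ?u x) * ennreal (?f x))"
    unfolding measure_pmf_eq_density by (subst density_density_eq) auto
  also have "(\<lambda>x. ennreal (pmf ?u x) * ennreal (?f x)) = (\<lambda>x. ennreal (pmf p x))"
  proof
    fix x
    have "pmf ?u x * ?f x = pmf p x"
    proof (cases "x \<in> A")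
      case True
      then show ?thesis using A ne c by (simp add: indicator_def)
    next
      case False
      then have "pmf p x = 0" using A(2) by (auto simp: set_pmf_iff)
      then show ?thesis by simp
    qed
    then show "ennreal (pmf ?u x) * ennreal (?f x) = ennreal (pmf p x)"
      by (simp add: ennreal_mult[symmetric])
  qed
  also have "density (count_space UNIV) (\<lambda>x. ennreal (pmf p x)) = measure_pmf p"
    by (simp add: measure_pmf_eq_density)
  finally have dens: "measure_pmf p = density (measure_pmf ?u) ?f" by simp
  have "rel_entropy b (measure_pmf p) (uniform_on A) = (\<integral>x. ?f x * log b (?f x) \<partial>measure_pmf ?u)"
    unfolding rel_entropy_def uniform_on_def by (subst dens, subst sigma_finite_measure.KL_density[OF prob_space_imp_sigma_finite[OF prob_space_measure_pmf] b]) auto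
  also have "\<dots> = (\<Sum>x\<in>A. ?f x * log b (?f x)) / card A"
    using A ne by (simp add: integral_pmf_of_set)
  also have "\<dots> = (\<Sum>x\<in>A. pmf p x * log b (?f x))"
    using c by (simp add: sum_divide_distrib)
  also have "\<dots> = (\<Sum>x\<in>set_pmf p. pmf p x * log b (?f x))"
    using A by (intro sum.mono_neutral_right) (auto simp: set_pmf_iff)
  also have "\<dots> = (\<Sum>x\<in>set_pmf p. log b (card A) * pmf p x + pmf p x * log b (pmf p x))"
    using b c by (intro sum.cong refl) (auto simp: log_mult set_pmf_iff algebra_simps)
  also have "\<dots> = log b (card A) * (\<Sum>x\<in>set_pmf p. pmf p x) - pmf_entropy b p"
    by (simp add: sum.distrib sum_distrib_left pmf_entropy_def)
  also have "(\<Sum>x\<in>set_pmf p. pmf p x) = 1"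
    using A by (intro sum_pmf_eq_1) (auto intro: finite_subset)
  finally show ?thesis by simp
qed

text \<open>On a finite type almost every point has positive mass, which makes the law discrete.
  This is the passage from variables on \<open>M\<close> to mass functions.\<close>

lemma law_eq_measure_pmf:
  fixes X :: "'w \<Rightarrow> 'x::finite"
  assumes "prob_space M" and [measurable]: "X \<in> measurable M (count_space UNIV)"
  obtains p where "law M X = measure_pmf p"
proof -
  interpret prob_space M by fact
  interpret D: prob_space "law M X" unfolding law_def by (rule prob_space_distr) simp
  have s: "sets (law M X) = UNIV" by (simp add: law_def)
  have "AE x in law M X. measure (law M X) {x} \<noteq> 0"
    unfolding D.AE_support_countable[OF s] by (intro exI[of _ UNIV]) (auto simp: countable_finite)
  then have "measure_pmf (Abs_pmf (law M X)) = law M X"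
    using s D.prob_space_axioms by (intro Abs_pmf_inverse) auto
  with that show ?thesis by metis
qed

lemma law_comp:
  assumes "X \<in> measurable M (count_space UNIV)" and "law M X = measure_pmf p"
  shows "law M (\<lambda>w. f (X w)) = measure_pmf (map_pmf f p)"
proof -
  have "measure_pmf (map_pmf f p) = distr (law M X) (count_space UNIV) f"
    by (simp add: map_pmf_rep_eq assms(2))
  also have "\<dots> = law M (\<lambda>w. f (X w))"
    using assms(1) by (simp add: law_def distr_distr comp_def)
  finally show ?thesis by simp
qed

lemma measure_law:
  assumes "X \<in> measurable M (count_space UNIV)"
  shows "measure (law M X) A = measure M (X -` A \<inter> space M)"
  using assms by (simp add: law_def measure_distr)

lemma mutual_info_eq_pmf:
  fixes S :: "'w \<Rightarrow> 's" and Y :: "'w \<Rightarrow> 't"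
  assumes M: "prob_space M" and b: "b > 1"
    and fin: "finite (S ` space M)" "finite (Y ` space M)"
    and [measurable]: "S \<in> measurable M (count_space UNIV)" "Y \<in> measurable M (count_space UNIV)"
    and [measurable]: "(\<lambda>w. (S w, Y w)) \<in> measurable M (count_space UNIV)"
    and p: "law M (\<lambda>w. (S w, Y w)) = measure_pmf p"
  shows "mutual_info b M S Y = pmf_mutual_info b p"
proof -
  interpret prob_space M by fact
  interpret information_space M b by standard (rule b)
  have lawS: "law M S = measure_pmf (map_pmf fst p)" and lawY: "law M Y = measure_pmf (map_pmf snd p)"
    using law_comp[OF _ p, of fst] law_comp[OF _ p, of snd] by simp_all
  have sS: "simple_function M S" and sY: "simple_function M Y" and sSY: "simple_function M (\<lambda>w. (S w, Y w))"
    using fin finite_subset[OF _ finite_cartesian_product[OF fin], of "(\<lambda>w. (S w, Y w)) ` space M"]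
    by (auto simp: simple_function_def)
  have dS: "simple_distributed M S (pmf (map_pmf fst p))"
    by (rule simple_distributedI[OF sS]) (auto simp: pmf.rep_eq measure_law simp flip: lawS)
  have dY: "simple_distributed M Y (pmf (map_pmf snd p))"
    by (rule simple_distributedI[OF sY]) (auto simp: pmf.rep_eq measure_law simp flip: lawY)
  have dSY: "simple_distributed M (\<lambda>w. (S w, Y w)) (pmf p)"
    by (rule simple_distributedI[OF sSY]) (auto simp: pmf.rep_eq measure_law simp flip: p)
  let ?I = "(\<lambda>w. (S w, Y w)) ` space M"
  have finI: "finite ?I" using dSY by (simp add: simple_distributed_finite)
  have sub: "set_pmf p \<subseteq> ?I"
  proof
    fix z assume "z \<in> set_pmf p"
    then have "measure (law M (\<lambda>w. (S w, Y w))) {z} \<noteq> 0" by (simp add: p set_pmf_iff pmf.rep_eq)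
    then have "(\<lambda>w. (S w, Y w)) -` {z} \<inter> space M \<noteq> {}" by (metis measure_law assms(7) measure_empty)
    then show "z \<in> ?I" by blast
  qed
  have finp: "finite (set_pmf p)" using sub finI by (rule finite_subset)
  have "mutual_info b M S Y =
      (\<Sum>(x, y)\<in>?I. pmf p (x, y) * log b (pmf p (x, y) / (pmf (map_pmf fst p) x * pmf (map_pmf snd p) y)))"
    unfolding mutual_info_def by (rule mutual_information_simple_distributed[OF dS dY dSY])
  \<comment> \<open>Attained pairs of probability 0 are dropped, so that every remaining logarithm
    splits.\<close>
  also have "\<dots> = (\<Sum>(x, y)\<in>set_pmf p. pmf p (x, y) * log b (pmf p (x, y) / (pmf (map_pmf fst p) x * pmf (map_pmf snd p) y)))"
    using sub finI by (intro sum.mono_neutral_right) (auto simp: set_pmf_iff)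
  also have "\<dots> = (\<Sum>z\<in>set_pmf p. pmf p z * log b (pmf p z)
      - pmf p z * log b (pmf (map_pmf fst p) (fst z)) - pmf p z * log b (pmf (map_pmf snd p) (snd z)))"
  proof (intro sum.cong refl)
    fix z assume z: "z \<in> set_pmf p"
    then have "pmf p z > 0" "pmf (map_pmf fst p) (fst z) > 0" "pmf (map_pmf snd p) (snd z) > 0"
      by (auto simp: pmf_positive)
    then show "(case z of (x, y) \<Rightarrow> pmf p (x, y) * log b (pmf p (x, y) / (pmf (map_pmf fst p) x * pmf (map_pmf snd p) y))) =
      pmf p z * log b (pmf p z)
      - pmf p z * log b (pmf (map_pmf fst p) (fst z)) - pmf p z * log b (pmf (map_pmf snd p) (snd z))"
      using b by (simp add: case_prod_unfold log_divide log_mult algebra_simps less_imp_neq[symmetric])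
  qed
  also have "\<dots> = pmf_mutual_info b p"
    by (simp add: pmf_mutual_info_def pmf_entropy_map_pmf[OF finp] pmf_entropy_def[of b p] sum_subtractf)
  finally show ?thesis .
qed

lemma pmf_entropy_UNIV:
  fixes p :: "'x::finite pmf"
  shows "pmf_entropy b p = - (\<Sum>x\<in>UNIV. pmf p x * log b (pmf p x))"
  unfolding pmf_entropy_def by (simp, intro sum.mono_neutral_left) (auto simp: set_pmf_iff)

text \<open>Chain rule: the averaged divergence is \<open>log b c\<close> minus H(X | S), and H(X |
  S) = H(S, X) - H(S). The common size \<open>c\<close> of the cosets makes the first term
  independent of the secret.\<close>

lemma cond_rel_entropy_uniform_eq:
  fixes S :: "'w \<Rightarrow> 's::finite" and X :: "'w \<Rightarrow> 'x::finite"
  assumes M: "prob_space M" and b: "b > 1"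
    and [measurable]: "S \<in> measurable M (count_space UNIV)" "X \<in> measurable M (count_space UNIV)"
      "(\<lambda>w. (S w, X w)) \<in> measurable M (count_space UNIV)"
    and p: "law M (\<lambda>w. (S w, X w)) = measure_pmf p"
    and supp: "\<And>s x. (s, x) \<in> set_pmf p \<Longrightarrow> x \<in> \<psi> s"
    and c: "\<And>s. card (\<psi> s) = c"
  shows "cond_rel_entropy_uniform b M S X \<psi> = log b c - pmf_entropy b p + pmf_entropy b (map_pmf fst p)"
proof -
  interpret prob_space M by fact
  let ?E = "event_eq M S"
  let ?P = "pmf (map_pmf fst p)"
  have E: "?E s \<in> sets M" for s unfolding event_eq_def by measurable
  have lawS: "law M S = measure_pmf (map_pmf fst p)"
    using law_comp[OF _ p, of fst] by simp
  have PE: "measure M (?E s) = ?P s" for s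
    using measure_law[of S M "{s}"] by (simp add: lawS pmf.rep_eq event_eq_def vimage_def Int_def conj_commute)
  have Psum: "?P s = (\<Sum>x\<in>UNIV. pmf p (s, x))" for s
  proof -
    have "fst -` {s} = Pair s ` (UNIV :: 'x set)" by auto
    then show ?thesis
      by (simp add: pmf_map measure_measure_pmf_finite sum.reindex inj_on_def)
  qed
  have summand: "?P s * rel_entropy b (law (uniform_measure M (?E s)) X) (uniform_on (\<psi> s)) =
      ?P s * log b c + (\<Sum>x\<in>UNIV. pmf p (s, x) * log b (pmf p (s, x))) - ?P s * log b (?P s)" for s
  proof (cases "?P s = 0")
    case True
    \<comment> \<open>A null secret has only null pairs, so both sides vanish whatever the
      conditioned measure is.\<close>
    then have "pmf p (s, x) = 0" for x
      using Psum[of s] by (simp add: sum_nonneg_eq_0_iff)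
    with True show ?thesis by simp
  next
    case False
    then have Ppos: "?P s > 0" by (simp add: pmf_positive set_pmf_iff)
    let ?U = "uniform_measure M (?E s)"
    have "prob_space ?U"
      using Ppos PE[of s] by (intro prob_space_uniform_measure) (auto simp: emeasure_eq_measure)
    moreover have XU: "X \<in> measurable ?U (count_space UNIV)" by simp
    ultimately obtain r where r: "law ?U X = measure_pmf r" by (rule law_eq_measure_pmf)
    have rx: "pmf r x = pmf p (s, x) / ?P s" for x
    proof -
      have "pmf r x = measure ?U (X -` {x} \<inter> space M)"
        using measure_law[OF XU, of "{x}"] by (simp add: r pmf.rep_eq)
      also have "\<dots> = measure M (?E s \<inter> (X -` {x} \<inter> space M)) / measure M (?E s)"
        using Ppos PE[of s] E by (intro measure_uniform_measure) (auto simp: emeasure_eq_measure)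
      also have "?E s \<inter> (X -` {x} \<inter> space M) = (\<lambda>w. (S w, X w)) -` {(s, x)} \<inter> space M"
        by (auto simp: event_eq_def)
      also have "measure M \<dots> = pmf p (s, x)"
        using measure_law[of "\<lambda>w. (S w, X w)" M "{(s, x)}"] by (simp add: p pmf.rep_eq)
      finally show ?thesis by (simp add: PE)
    qed
    have "set_pmf r \<subseteq> \<psi> s"
      using supp by (auto simp: set_pmf_iff rx)
    then have "rel_entropy b (law ?U X) (uniform_on (\<psi> s)) = log b c - pmf_entropy b r"
      using b by (simp add: r rel_entropy_uniform_on c)
    then have "?P s * rel_entropy b (law ?U X) (uniform_on (\<psi> s)) =
        ?P s * log b c + (\<Sum>x\<in>UNIV. ?P s * (pmf r x * log b (pmf r x)))"
      by (simp add: pmf_entropy_UNIV algebra_simps sum_distrib_left)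
    also have "(\<Sum>x\<in>UNIV. ?P s * (pmf r x * log b (pmf r x))) =
        (\<Sum>x\<in>UNIV. pmf p (s, x) * log b (pmf p (s, x)) - pmf p (s, x) * log b (?P s))"
    proof (intro sum.cong refl)
      fix x
      \<comment> \<open>Null pairs are treated apart, since the logarithm of the quotient splits
        only for positive masses.\<close>
      show "?P s * (pmf r x * log b (pmf r x)) = pmf p (s, x) * log b (pmf p (s, x)) - pmf p (s, x) * log b (?P s)"
        using Ppos b by (cases "pmf p (s, x) = 0") (auto simp: rx log_divide algebra_simps)
    qed
    also have "\<dots> = (\<Sum>x\<in>UNIV. pmf p (s, x) * log b (pmf p (s, x))) - ?P s * log b (?P s)"
      by (simp add: sum_subtractf Psum sum_distrib_right)
    finally show ?thesis by simp
  qed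
  have "cond_rel_entropy_uniform b M S X \<psi> = (\<Sum>s\<in>UNIV. ?P s) * log b c
      + (\<Sum>s\<in>UNIV. \<Sum>x\<in>UNIV. pmf p (s, x) * log b (pmf p (s, x))) - (\<Sum>s\<in>UNIV. ?P s * log b (?P s))"
    unfolding cond_rel_entropy_uniform_def PE summand
    by (simp add: sum_subtractf sum.distrib sum_distrib_right)
  also have "(\<Sum>s\<in>UNIV. ?P s) = 1" by (simp add: sum_pmf_eq_1)
  also have "(\<Sum>s\<in>UNIV. \<Sum>x\<in>UNIV. pmf p (s, x) * log b (pmf p (s, x))) = - pmf_entropy b p"
    by (simp add: pmf_entropy_UNIV sum.cartesian_product)
  finally show ?thesis by (simp add: pmf_entropy_UNIV)
qed

section \<open>Observations of a coset-encoded secret\<close>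

lemma mat_apply_eq_iff:
  "mat_apply B x = mat_apply B y \<longleftrightarrow> x - y \<in> dual_code (set B)"
  by (auto simp: mat_apply_def dual_code_def std_bilinear_diff_right)

text \<open>The fibre is the translate by \<open>z0\<close> of the part of the kernel inside
  \<open>C\<close>.\<close>

lemma card_coset_fibre:
  fixes C :: "('a::{field,finite} ^ 'n) set"
  assumes "vec.subspace C"
  shows "card {z \<in> z0 +o C. mat_apply B z = mat_apply B z0} = card (C \<inter> dual_code (set B))"
proof -
  have "{z \<in> z0 +o C. mat_apply B z = mat_apply B z0} = (+) z0 ` (C \<inter> dual_code (set B))"
    by (auto simp: elt_set_plus_def mat_apply_eq_iff)
  then show ?thesis by (simp add: card_image)
qed

lemma coset_eq:
  fixes C :: "('a::field ^ 'n) set"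
  assumes C: "vec.subspace C" and z: "z \<in> x +o C"
  shows "x +o C = z +o C"
proof -
  obtain c where c: "c \<in> C" "z = x + c" using z by (auto simp: elt_set_plus_def)
  show ?thesis
  proof (intro equalityI subsetI)
    fix y assume "y \<in> x +o C"
    then obtain d where d: "d \<in> C" "y = x + d" by (auto simp: elt_set_plus_def)
    then have "y = z + (d - c)" "d - c \<in> C" using c C by (auto simp: vec_subspace_closed)
    then show "y \<in> z +o C" by (auto simp: elt_set_plus_def)
  next
    fix y assume "y \<in> z +o C"
    then obtain d where d: "d \<in> C" "y = z + d" by (auto simp: elt_set_plus_def)
    then have "y = x + (c + d)" "c + d \<in> C" using c C by (auto simp: vec_subspace_closed algebra_simps)
    then show "y \<in> x +o C" by (auto simp: elt_set_plus_def)
  qed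
qed

text \<open>Rank-nullity by counting: all nonempty fibres on \<open>C\<close> have the size of the
  kernel.\<close>

lemma card_image_mat_apply:
  fixes C :: "('a::{field,finite} ^ 'n) set"
  assumes C: "vec.subspace C"
  shows "card (mat_apply B ` C) * card (C \<inter> dual_code (set B)) = card C"
proof -
  have "card C = (\<Sum>y\<in>mat_apply B ` C. card {x \<in> C. mat_apply B x = y})"
    using sum.image_gen[of C "\<lambda>_. 1 :: nat" "mat_apply B"] by simp
  also have "\<dots> = (\<Sum>y\<in>mat_apply B ` C. card (C \<inter> dual_code (set B)))"
  proof (intro sum.cong refl)
    fix y assume "y \<in> mat_apply B ` C"
    then obtain z where z: "z \<in> C" "y = mat_apply B z" by blast
    \<comment> \<open>\<open>C\<close> is its own coset through \<open>z\<close>, so the fibre count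
      for cosets applies.\<close>
    then have "z +o C = C" using coset_eq[OF C, of z 0] by (simp add: elt_set_plus_def)
    then show "card {x \<in> C. mat_apply B x = y} = card (C \<inter> dual_code (set B))"
      using card_coset_fibre[OF C, of z B] z(2) by simp
  qed
  finally show ?thesis by simp
qed

text \<open>The joint distribution of secret and observation when \<open>P\<close> is that of secret
  and codeword.\<close>

definition observed ::
  "('s \<times> ('a::comm_ring_1 ^ 'n)) pmf \<Rightarrow> ('a ^ 'n) list \<Rightarrow> ('s \<times> 'a list) pmf" where
  "observed P B = map_pmf (\<lambda>(s, x). (s, mat_apply B x)) P"

text \<open>With the base \<open>CARD('a)\<close>, logarithms of cardinalities of subspaces are
  dimensions.\<close>

locale nested_codes =
  fixes C1 C2 :: "('a::{field,finite} ^ 'n) set" and \<psi> :: "'a ^ 'l \<Rightarrow> ('a ^ 'n) set" and b :: real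
  assumes b_eq: "b = CARD('a)" and C1: "vec.subspace C1" and C2: "vec.subspace C2" and C21: "C2 \<subseteq> C1"
    and dims: "vec.dim C1 = vec.dim C2 + CARD('l)"
    and psi: "bij_betw \<psi> UNIV (quotient_code C1 C2)"
begin

abbreviation ker :: "('a ^ 'n) list \<Rightarrow> ('a ^ 'n) set" where "ker B \<equiv> dual_code (set B)"

text \<open>Real-valued counterpart of the integer \<open>gain\<close> in
  \<open>RDIP_matrix_bound\<close>, to be compared with entropies.\<close>

definition gain :: "('a ^ 'n) list \<Rightarrow> real" where
  "gain B = real (vec.dim C1) - vec.dim C2 - vec.dim (C1 \<inter> ker B) + vec.dim (C2 \<inter> ker B)"

lemma b_gt_1: "b > 1"
  using card_field_gt_1[where 'a = 'a] by (simp add: b_eq)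

lemma log_power: "log b (CARD('a) ^ k) = k"
  using b_gt_1 by (simp add: b_eq log_nat_power)

lemma log_card_subspace: "vec.subspace V \<Longrightarrow> log b (card V) = vec.dim V"
  for V :: "('a ^ 'k) set"
  using log_power by (simp add: card_subspace)

lemma psi_coset: "x \<in> \<psi> s \<Longrightarrow> \<psi> s = x +o C2"
proof -
  assume x: "x \<in> \<psi> s"
  have "\<psi> s \<in> quotient_code C1 C2" using psi by (auto simp: bij_betw_def)
  with x show ?thesis using coset_eq[OF C2] by (auto simp: quotient_code_def)
qed

lemma psi_subset: "\<psi> s \<subseteq> C1"
proof -
  have "\<psi> s \<in> quotient_code C1 C2" using psi by (auto simp: bij_betw_def)
  then show ?thesis using C21 C1
    by (auto simp: quotient_code_def elt_set_plus_def subset_iff intro!: vec.subspace_add)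
qed

lemma psi_disjoint: "x \<in> \<psi> s \<Longrightarrow> x \<in> \<psi> t \<Longrightarrow> s = t"
  using psi_coset psi by (metis bij_betw_def injD)

lemma card_psi: "card (\<psi> s) = card C2"
proof -
  have "\<psi> s \<in> quotient_code C1 C2" using psi by (auto simp: bij_betw_def)
  then obtain x where "\<psi> s = x +o C2" by (auto simp: quotient_code_def)
  also have "x +o C2 = (+) x ` C2" by (auto simp: elt_set_plus_def)
  finally have "\<psi> s = (+) x ` C2" .
  then show ?thesis by (simp add: card_image)
qed

lemma card_psi_fibre_le: "card {x \<in> \<psi> s. mat_apply B x = y} \<le> card (C2 \<inter> ker B)"
proof (cases "{x \<in> \<psi> s. mat_apply B x = y} = {}")
  case True
  then show ?thesis by (simp only: card.empty)
next
  case False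
  then obtain z where z: "z \<in> \<psi> s" "mat_apply B z = y" by blast
  then show ?thesis using card_coset_fibre[OF C2, of z B] psi_coset[of z s] by simp
qed

lemma dim_kernels_le: "vec.dim (C2 \<inter> ker B) \<le> vec.dim (C1 \<inter> ker B)"
  using C21 by (intro vec.dim_subset) auto

text \<open>Each compatible secret owns a translate of \<open>C2 \<inter> ker B\<close> in the fibre
  over \<open>y\<close>; these translates are disjoint and fit together into one translate of
  \<open>C1 \<inter> ker B\<close>.\<close>

lemma card_compatible_secrets_le:
  "card {s. \<exists>x\<in>\<psi> s. mat_apply B x = y} \<le> CARD('a) ^ (vec.dim (C1 \<inter> ker B) - vec.dim (C2 \<inter> ker B))"
proof -
  let ?T = "{s. \<exists>x\<in>\<psi> s. mat_apply B x = y}"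
  let ?X = "\<lambda>s. {x \<in> \<psi> s. mat_apply B x = y}"
  have X: "card (?X s) = card (C2 \<inter> ker B)" if s: "s \<in> ?T" for s
  proof -
    from s obtain z where z: "z \<in> \<psi> s" "mat_apply B z = y" by blast
    then show ?thesis using card_coset_fibre[OF C2, of z B] psi_coset[of z s] by simp
  qed
  have "card ?T * card (C2 \<inter> ker B) = (\<Sum>s\<in>?T. card (?X s))" using X by simp
  also have "\<dots> = card (\<Union>s\<in>?T. ?X s)"
    using psi_disjoint by (intro card_UN_disjoint[symmetric]) auto
  also have "\<dots> \<le> card (C1 \<inter> ker B)"
  proof (cases "?T = {}")
    case False
    then obtain s z where z: "z \<in> \<psi> s" "mat_apply B z = y" by blast
    then have "z \<in> C1" using psi_subset by blast
    then have "z +o C1 = C1" using coset_eq[OF C1, of z 0] by (simp add: elt_set_plus_def)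
    have "card (\<Union>s\<in>?T. ?X s) \<le> card {x \<in> z +o C1. mat_apply B x = mat_apply B z}"
      using psi_subset z(2) \<open>z +o C1 = C1\<close> by (intro card_mono) auto
    then show ?thesis using card_coset_fibre[OF C1] by simp
  qed simp
  \<comment> \<open>The natural-number subtraction in the exponent is exact by
    \<open>dim_kernels_le\<close>.\<close>
  finally have "card ?T * CARD('a) ^ vec.dim (C2 \<inter> ker B) \<le>
      CARD('a) ^ (vec.dim (C1 \<inter> ker B) - vec.dim (C2 \<inter> ker B)) * CARD('a) ^ vec.dim (C2 \<inter> ker B)"
    using dim_kernels_le[of B]
    by (simp add: card_subspace C1 C2 vec.subspace_inter subspace_dual_code flip: power_add)
  then show ?thesis by simp
qed

text \<open>The sum of \<open>C2\<close> and \<open>C1 \<inter> ker B\<close> stays inside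
  \<open>C1\<close>, and the two meet in \<open>C2 \<inter> ker B\<close>.\<close>

lemma gain_nonneg: "gain B \<ge> 0"
proof -
  let ?D = "C1 \<inter> ker B"
  have D: "vec.subspace ?D" using C1 by (simp add: vec.subspace_inter subspace_dual_code)
  have "{x + y |x y. x \<in> C2 \<and> y \<in> ?D} \<subseteq> C1"
    using C21 C1 by (auto intro: vec_subspace_closed)
  then have "vec.dim {x + y |x y. x \<in> C2 \<and> y \<in> ?D} \<le> vec.dim C1" by (rule vec.dim_subset)
  moreover have "C2 \<inter> ?D = C2 \<inter> ker B" using C21 by auto
  ultimately show ?thesis using vec.dim_sums_Int[OF C2 D] by (simp add: gain_def)
qed

section \<open>Information bounds for a fixed matrix and a fixed joint distribution\<close>

context
  fixes P :: "(('a ^ 'l) \<times> ('a ^ 'n)) pmf"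
  assumes supp: "\<And>s x. (s, x) \<in> set_pmf P \<Longrightarrow> x \<in> \<psi> s"
begin

lemma finite_observed: "finite (set_pmf (observed P B))"
  by (simp add: observed_def)

lemma fst_observed: "map_pmf fst (observed P B) = map_pmf fst P"
  by (simp add: observed_def map_pmf_comp case_prod_unfold)

lemma observed_compatible: "(s, y) \<in> set_pmf (observed P B) \<Longrightarrow> \<exists>x\<in>\<psi> s. mat_apply B x = y"
  using supp by (auto simp: observed_def)

text \<open>
  Bounds \<open>H(Y)\<close> by the size of \<open>B C1\<close>, and \<open>H(S, X) - H(S, Y)\<close> by the number of vectors of a
  coset of \<open>C2\<close> with the same image under \<open>B\<close>.
\<close>

lemma observed_upper:
  "pmf_mutual_info b (observed P B) \<le>
    gain B + (vec.dim C2 - pmf_entropy b P + pmf_entropy b (map_pmf fst P))"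
proof -
  have "pmf_entropy b (map_pmf snd (observed P B)) \<le> log b (card (mat_apply B ` C1))"
  proof (rule pmf_entropy_le_log_card[OF _ b_gt_1])
    show "finite (set_pmf (map_pmf snd (observed P B)))" using finite_observed by simp
    have "set_pmf (map_pmf snd (observed P B)) \<subseteq> mat_apply B ` C1"
      using observed_compatible psi_subset by fastforce
    then show "card (set_pmf (map_pmf snd (observed P B))) \<le> card (mat_apply B ` C1)"
      by (intro card_mono) auto
  qed
  also have "\<dots> = real (vec.dim C1) - vec.dim (C1 \<inter> ker B)"
  proof -
    have s: "vec.subspace (C1 \<inter> ker B)" using C1 by (simp add: vec.subspace_inter subspace_dual_code)
    have "card (mat_apply B ` C1) \<noteq> 0" using vec.subspace_0[OF C1] by auto
    moreover have "card (C1 \<inter> ker B) \<noteq> 0" using vec.subspace_0[OF s] by auto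
    ultimately have "log b (card (mat_apply B ` C1)) + log b (card (C1 \<inter> ker B)) = log b (card C1)"
      unfolding card_image_mat_apply[OF C1, of B, symmetric] by (simp add: log_mult)
    then show ?thesis by (simp only: log_card_subspace[OF s] log_card_subspace[OF C1])
  qed
  finally have Y: "pmf_entropy b (map_pmf snd (observed P B)) \<le> real (vec.dim C1) - vec.dim (C1 \<inter> ker B)" .
  have "pmf_entropy b P \<le> pmf_entropy b (observed P B) + log b (card (C2 \<inter> ker B))"
    unfolding observed_def
  proof (rule pmf_entropy_le_map_log_fibre[OF _ b_gt_1])
    show "card {z \<in> set_pmf P. (case z of (s, x) \<Rightarrow> (s, mat_apply B x)) = y} \<le> card (C2 \<inter> ker B)" for y
    proof -
      \<comment> \<open>A fibre over \<open>y\<close> fixes the secret \<open>fst y\<close> and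
        hence stays within one coset of \<open>C2\<close>.\<close>
      have "{z \<in> set_pmf P. (case z of (s, x) \<Rightarrow> (s, mat_apply B x)) = y} \<subseteq>
          Pair (fst y) ` {x \<in> \<psi> (fst y). mat_apply B x = snd y}"
        using supp by auto
      then have "card {z \<in> set_pmf P. (case z of (s, x) \<Rightarrow> (s, mat_apply B x)) = y} \<le>
          card (Pair (fst y) ` {x \<in> \<psi> (fst y). mat_apply B x = snd y})"
        by (intro card_mono) auto
      also have "\<dots> = card {x \<in> \<psi> (fst y). mat_apply B x = snd y}"
        by (simp add: card_image inj_on_def)
      finally show ?thesis using card_psi_fibre_le order_trans by blast
    qed
  qed simp
  also have "log b (card (C2 \<inter> ker B)) = vec.dim (C2 \<inter> ker B)"
    by (rule log_card_subspace) (simp add: C2 vec.subspace_inter subspace_dual_code)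
  finally show ?thesis using Y by (simp add: pmf_mutual_info_def fst_observed gain_def)
qed

text \<open>Bounds \<open>H(S | Y)\<close> by the number of secrets compatible with an observation.\<close>

lemma observed_lower:
  "gain B - (CARD('l) - pmf_entropy b (map_pmf fst P)) \<le> pmf_mutual_info b (observed P B)"
proof -
  let ?N = "CARD('a) ^ (vec.dim (C1 \<inter> ker B) - vec.dim (C2 \<inter> ker B))"
  have "pmf_entropy b (observed P B) \<le> pmf_entropy b (map_pmf snd (observed P B)) + log b ?N"
  proof (rule pmf_entropy_le_map_log_fibre[OF finite_observed b_gt_1])
    fix y
    have "{z \<in> set_pmf (observed P B). snd z = y} \<subseteq> (\<lambda>s. (s, y)) ` {s. \<exists>x\<in>\<psi> s. mat_apply B x = y}"
      using observed_compatible by force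
    then have "card {z \<in> set_pmf (observed P B). snd z = y} \<le>
        card ((\<lambda>s. (s, y)) ` {s. \<exists>x\<in>\<psi> s. mat_apply B x = y})"
      by (intro card_mono) auto
    also have "\<dots> = card {s. \<exists>x\<in>\<psi> s. mat_apply B x = y}"
      by (simp add: card_image inj_on_def)
    finally show "card {z \<in> set_pmf (observed P B). snd z = y} \<le> ?N"
      using card_compatible_secrets_le order_trans by blast
  qed
  also have "log b ?N = real (vec.dim (C1 \<inter> ker B)) - vec.dim (C2 \<inter> ker B)"
    using b_gt_1 dim_kernels_le[of B] by (simp add: log_power of_nat_diff del: of_nat_power)
  finally show ?thesis
    by (simp add: pmf_mutual_info_def fst_observed gain_def dims)
qed

text \<open>Without leakage the support of the joint distribution is a product, so one observation
  \<open>y\<close> is compatible with all \<open>CARD('a) ^ CARD('l)\<close> secrets. The bound on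
  compatible secrets then makes the kernel dimensions differ by at least
  \<open>CARD('l)\<close>.\<close>

lemma observed_zero:
  assumes le: "pmf_mutual_info b (observed P B) \<le> 0" and full: "fst ` set_pmf P = UNIV"
  shows "gain B \<le> 0"
proof -
  obtain s0 y where y: "(s0, y) \<in> set_pmf (observed P B)"
    using set_pmf_not_empty[of "observed P B"] by (metis ex_in_conv surj_pair)
  have "fst ` set_pmf (observed P B) = UNIV"
    using full by (simp flip: set_map_pmf add: fst_observed)
  then have "(s, y) \<in> set_pmf (observed P B)" for s
    using pmf_mutual_info_nonpos_support[OF finite_observed b_gt_1 le] y by force
  then have "{s. \<exists>x\<in>\<psi> s. mat_apply B x = y} = UNIV"
    using observed_compatible by blast
  then have "CARD('a ^ 'l) \<le> CARD('a) ^ (vec.dim (C1 \<inter> ker B) - vec.dim (C2 \<inter> ker B))"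
    using card_compatible_secrets_le[of B y] by simp
  then have "CARD('l) \<le> vec.dim (C1 \<inter> ker B) - vec.dim (C2 \<inter> ker B)"
    using card_field_gt_1[where 'a = 'a] by (simp add: power_increasing_iff)
  then show ?thesis using dim_kernels_le[of B] by (simp add: gain_def dims of_nat_diff)
qed

end

end

section \<open>Transfer to random variables and maximisation over all matrices\<close>

theorem theorem26:
  fixes F :: "'a::{field,finite} set" and q m \<mu> :: nat
    and C1 C2 :: "('a ^ 'n) set"
    and \<psi> :: "'a ^ 'l \<Rightarrow> ('a ^ 'n) set"
    and M :: "'w measure" and S :: "'w \<Rightarrow> 'a ^ 'l" and X :: "'w \<Rightarrow> 'a ^ 'n"
  assumes "is_subfield F" and "card F = q" and "m \<ge> 1" and "CARD('a) = q ^ m"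
    and "vec.subspace C1" and "vec.subspace C2" and "C2 \<subset> C1"
    and "vec.dim C1 = vec.dim C2 + CARD('l)"
    and "bij_betw \<psi> UNIV (quotient_code C1 C2)" and "linear_to_quotient C2 \<psi>"
    and "prob_space M"
    and "S \<in> measurable M (count_space UNIV)" and "X \<in> measurable M (count_space UNIV)"
    and "AE w in M. X w \<in> \<psi> (S w)"
    and "\<mu> \<le> CARD('n)"
  defines "b \<equiv> real (q ^ m)"
    and "K \<equiv> real_of_int (RDIP q \<mu> (dual_code C2) (dual_code C1))"
  shows "K - rel_entropy b (law M S) (uniform_on UNIV) \<le> max_mutual_info b F \<mu> M S X \<and>
    max_mutual_info b F \<mu> M S X \<le> K + cond_rel_entropy_uniform b M S X \<psi> \<and>
    (law M S = uniform_on UNIV \<and> law M X = uniform_on C1 \<longrightarrow>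
      max_mutual_info b F \<mu> M S X = K) \<and>
    (max_mutual_info b F \<mu> M S X = 0 \<and> (\<forall>s. measure M (event_eq M S s) > 0) \<longrightarrow> K = 0)"
proof -
  interpret nested_codes C1 C2 \<psi> b using assms by unfold_locales auto
  note [measurable] = \<open>S \<in> measurable M (count_space UNIV)\<close> \<open>X \<in> measurable M (count_space UNIV)\<close>
  note b1 = b_gt_1
  have q: "card F = q" by fact
  \<comment> \<open>The pair takes values in a finite type, so preimages of singletons
    suffice.\<close>
  have SX: "(\<lambda>w. (S w, X w)) \<in> measurable M (count_space UNIV)"
  proof (subst measurable_count_space_eq2, simp, intro conjI ballI)
    fix z :: "('a ^ 'l) \<times> ('a ^ 'n)"
    have "(\<lambda>w. (S w, X w)) -` {z} \<inter> space M = {w \<in> space M. S w = fst z \<and> X w = snd z}" by auto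
    also have "\<dots> \<in> sets M" by measurable
    finally show "(\<lambda>w. (S w, X w)) -` {z} \<inter> space M \<in> sets M" .
  qed simp
  from \<open>prob_space M\<close> this obtain P where P: "law M (\<lambda>w. (S w, X w)) = measure_pmf P"
    by (rule law_eq_measure_pmf)
  have lawS: "law M S = measure_pmf (map_pmf fst P)" and lawX: "law M X = measure_pmf (map_pmf snd P)"
    using law_comp[OF SX P, of fst] law_comp[OF SX P, of snd] by simp_all
  have "AE z in law M (\<lambda>w. (S w, X w)). snd z \<in> \<psi> (fst z)"
    unfolding law_def using SX assms(14) by (subst AE_distr_iff) auto
  then have "\<forall>z\<in>set_pmf P. snd z \<in> \<psi> (fst z)"
    by (simp only: P AE_measure_pmf_iff)
  then have supp: "x \<in> \<psi> s" if "(s, x) \<in> set_pmf P" for s x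
    using that by fastforce
  have upper: "pmf_mutual_info b (observed P B) \<le>
      gain B + (vec.dim C2 - pmf_entropy b P + pmf_entropy b (map_pmf fst P))" for B
    by (rule observed_upper) (rule supp)
  have lower: "gain B - (CARD('l) - pmf_entropy b (map_pmf fst P)) \<le> pmf_mutual_info b (observed P B)" for B
    by (rule observed_lower) (rule supp)
  have zero: "gain B \<le> 0" if "pmf_mutual_info b (observed P B) \<le> 0" "fst ` set_pmf P = UNIV" for B
    by (rule observed_zero[OF _ that]) (rule supp)
  have mi: "mutual_info b M S (\<lambda>w. mat_apply B (X w)) = pmf_mutual_info b (observed P B)" for B
  proof (rule mutual_info_eq_pmf[OF \<open>prob_space M\<close> b1])
    show "finite (S ` space M)" by simp
    have "(\<lambda>w. mat_apply B (X w)) ` space M \<subseteq> range (mat_apply B)" by auto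
    then show "finite ((\<lambda>w. mat_apply B (X w)) ` space M)" by (rule finite_subset) simp
    show "S \<in> measurable M (count_space UNIV)" by fact
    show "(\<lambda>w. mat_apply B (X w)) \<in> measurable M (count_space UNIV)" by measurable
    have "(\<lambda>w. (\<lambda>(s, x). (s, mat_apply B x)) (S w, X w)) \<in> measurable M (count_space UNIV)"
      by (rule measurable_compose[OF SX]) simp
    then show "(\<lambda>w. (S w, mat_apply B (X w))) \<in> measurable M (count_space UNIV)" by simp
    show "law M (\<lambda>w. (S w, mat_apply B (X w))) = measure_pmf (observed P B)"
      using law_comp[OF SX P, of "\<lambda>(s, x). (s, mat_apply B x)"] by (simp add: observed_def)
  qed
  have DS: "rel_entropy b (law M S) (uniform_on UNIV) = CARD('l) - pmf_entropy b (map_pmf fst P)"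
    using b1 log_power[of "CARD('l)"] by (simp add: lawS rel_entropy_uniform_on)
  have DX: "cond_rel_entropy_uniform b M S X \<psi> =
      vec.dim C2 - pmf_entropy b P + pmf_entropy b (map_pmf fst P)"
    using cond_rel_entropy_uniform_eq[OF \<open>prob_space M\<close> b1 _ _ SX P supp card_psi] log_card_subspace[OF C2]
    by simp
  have gain_le: "gain B \<le> K" if "B \<in> matrices_over F \<mu>" for B
    using RDIP_matrix_bound(1)[OF assms(1) assms(15) C1 C2 C21 that]
    unfolding K_def gain_def q by linarith
  \<comment> \<open>\<open>B0\<close> attains the largest gain; it serves for the lower bound and
    for the claim on vanishing information.\<close>
  obtain B0 where B0: "B0 \<in> matrices_over F \<mu>" "gain B0 = K"
  proof -
    obtain B where B: "B \<in> matrices_over F \<mu>"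
        "int (vec.dim C1) - int (vec.dim C2) - int (vec.dim (C1 \<inter> ker B)) + int (vec.dim (C2 \<inter> ker B)) =
          RDIP q \<mu> (dual_code C2) (dual_code C1)"
      using RDIP_matrix_bound(2)[OF assms(1) assms(15) C1 C2 C21] unfolding q by blast
    then have "gain B = K" unfolding K_def gain_def by linarith
    with B(1) that show ?thesis by blast
  qed
  let ?I = "\<lambda>B. mutual_info b M S (\<lambda>w. mat_apply B (X w))"
  have fin: "finite (?I ` matrices_over F \<mu>)"
  proof -
    have "matrices_over F \<mu> \<subseteq> {B :: ('a ^ 'n) list. set B \<subseteq> UNIV \<and> length B = \<mu>}"
      by (auto simp: matrices_over_def)
    then have "finite (matrices_over F \<mu> :: ('a ^ 'n) list set)"
      by (rule finite_subset[OF _ finite_lists_length_eq[OF finite]])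
    then show ?thesis by simp
  qed
  have "?I B0 \<in> ?I ` matrices_over F \<mu>" using B0 by blast
  then have max_ge: "?I B0 \<le> max_mutual_info b F \<mu> M S X"
    and max_in: "max_mutual_info b F \<mu> M S X \<in> ?I ` matrices_over F \<mu>"
    unfolding max_mutual_info_def using fin by (auto intro!: Max_ge Max_in)
  have c1: "K - rel_entropy b (law M S) (uniform_on UNIV) \<le> max_mutual_info b F \<mu> M S X"
    using max_ge lower[of B0] B0(2) by (simp add: mi DS)
  have c2: "max_mutual_info b F \<mu> M S X \<le> K + cond_rel_entropy_uniform b M S X \<psi>"
  proof -
    \<comment> \<open>The upper bound is applied at a matrix maximising the information, whose gain
      is at most \<open>K\<close>.\<close>
    obtain B where B: "B \<in> matrices_over F \<mu>" "max_mutual_info b F \<mu> M S X = ?I B"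
      using max_in by blast
    then show ?thesis using upper[of B] gain_le[OF B(1)] by (simp add: mi DX)
  qed
  have c3: "max_mutual_info b F \<mu> M S X = K"
    if "law M S = uniform_on UNIV" "law M X = uniform_on C1"
  proof -
    have "map_pmf fst P = pmf_of_set UNIV" "map_pmf snd P = pmf_of_set C1"
      using that by (simp_all add: lawS lawX uniform_on_def measure_pmf_inject)
    moreover have "C1 \<noteq> {}" using vec.subspace_0[OF C1] by auto
    ultimately have "pmf_entropy b (map_pmf fst P) = CARD('l)"
      and "pmf_entropy b (map_pmf snd P) = vec.dim C1"
      using b1 log_card_subspace[OF C1] log_power[of "CARD('l)"]
      by (simp_all add: pmf_entropy_pmf_of_set)
    \<comment> \<open>H(S, X) is at least H(X) = dim C1 = dim C2 + l, so the conditional divergence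
      is at most 0. As the divergence of \<open>S\<close> is 0, the two bounds \<open>c1\<close> and
      \<open>c2\<close> meet.\<close>
    moreover have "pmf_entropy b (map_pmf snd P) \<le> pmf_entropy b P"
      by (rule pmf_entropy_map_le[OF _ b1]) simp
    ultimately show ?thesis using c1 c2 by (simp add: DS DX dims)
  qed
  have c4: "K = 0"
    if z: "max_mutual_info b F \<mu> M S X = 0" and pos: "\<forall>s. measure M (event_eq M S s) > 0"
  proof -
    have "s \<in> fst ` set_pmf P" for s
    proof -
      have "pmf (map_pmf fst P) s = measure M (event_eq M S s)"
        using measure_law[of S M "{s}"]
        by (simp add: lawS pmf.rep_eq event_eq_def vimage_def Int_def conj_commute)
      then have "pmf (map_pmf fst P) s > 0" using pos by simp
      then have "s \<in> set_pmf (map_pmf fst P)" unfolding set_pmf_iff by linarith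
      then show ?thesis by simp
    qed
    then have "fst ` set_pmf P = UNIV" by blast
    \<comment> \<open>The information at \<open>B0\<close> is at most the maximum 0, so
      \<open>zero\<close> bounds the gain of \<open>B0\<close>, which is \<open>K\<close>.\<close>
    then have "K \<le> 0" using zero[of B0] max_ge z B0(2) by (simp add: mi)
    moreover have "0 \<le> K" using gain_nonneg[of B0] B0(2) by simp
    ultimately show ?thesis by simp
  qed
  show ?thesis using c1 c2 c3 c4 by blast
qed

end
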